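(* Let $G = G_1\times G_2$ be a finite group and let $K$ be a field on which $G$ acts (by field automorphisms) such that (i) $[K:k]<\infty$, where $k = K^G$, and (ii) the kernel of the induced homomorphism $G\to \operatorname{Gal}(K/k)$ is $G_1$. Let $K(x(g): g\in G)$ be the rational function field over $K$ in the $|G|$ variables $x(g)$, $g\in G$, equipped with the action of $G$ by field automorphisms such that $G$ acts on $K$ as given and $h\cdot x(g) = x(hg)$ for any $h,g\in G$. If $k(G_1)$ is $k$-rational, then $K(x(g): g\in G)^G$ is also $k$-rational. Conversely, if $K(x(g): g\in G)^G$ is $k$-rational, then $k(G_1)$ is stably $k$-rational.
   Context: A finitely generated field extension $L$ of a field $k$ is called $k$-rational if $L$ is purely transcendental over $k$; it is called stably $k$-rational if $L(t_1,\ldots,t_m)$ is $k$-rational for some elements $t_1,\ldots,t_m$ algebraically independent over $L$. For a group $G$ acting on a field $F$ by automorphisms, $F^G$ denotes the fixed field. For a finite group $H$ and a field $k$, $k(H)$ denotes the fixed field $k(y(h): h\in H)^H$, where $k(y(h): h\in H)$ is the rational function field over $k$ in $|H|$ variables $y(h)$, $h \in H$, on which $H$ acts by $k$-automorphisms with $h'\cdot y(h) = y(h'h)$ for all $h',h\in H$. *)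

theory Defs
  imports
    "HOL-Algebra.Group_Action"
    "HOL-Computational_Algebra.Fraction_Field"
    "HOL-Library.Poly_Mapping"
    "HOL.Hull"
begin

section \<open>Rational function fields in arbitrary indeterminates\<close>

text \<open>
  The library makes polynomials over a field an integral domain only if the indeterminates are
  linearly ordered. Therefore indeterminates are wrapped in a type that carries an
  arbitrarily chosen well-order; nothing else depends on this order.
\<close>

datatype 'v indet = Indet (unindet: 'v)

instantiation indet :: (type) linorder
begin

definition less_eq_indet :: "'v indet \<Rightarrow> 'v indet \<Rightarrow> bool" where
  "less_eq_indet a b \<longleftrightarrow> (a, b) \<in> (SOME r. well_order_on UNIV r)"

definition less_indet :: "'v indet \<Rightarrow> 'v indet \<Rightarrow> bool" where
  "less_indet a b \<longleftrightarrow> a \<le> b \<and> \<not> b \<le> a"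

instance
proof -
  define r :: "'v indet rel" where "r = (SOME r. well_order_on UNIV r)"
  have "well_order_on UNIV r"
    unfolding r_def by (rule someI_ex) (rule well_order_on)
  then have lin: "linear_order_on UNIV r"
    by (simp add: well_order_on_def)
  then have 1: "refl r" "trans r" "antisym r" "total r"
    by (auto simp: order_on_defs)
  have le: "(a \<le> b) = ((a, b) \<in> r)" for a b :: "'v indet"
    by (simp add: less_eq_indet_def r_def)
  show "OFCLASS('v indet, linorder_class)"
  proof
    fix x y z :: "'v indet"
    show "(x < y) = (x \<le> y \<and> \<not> y \<le> x)" by (rule less_indet_def)
    show "x \<le> x" using 1(1) by (simp add: le refl_on_def)
    show "x \<le> y \<Longrightarrow> y \<le> z \<Longrightarrow> x \<le> z" using 1(2) by (auto simp: le dest: transD)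
    show "x \<le> y \<Longrightarrow> y \<le> x \<Longrightarrow> x = y" using 1(3) by (auto simp: le dest: antisymD)
    show "x \<le> y \<or> y \<le> x" using 1(1,4) by (cases "x = y") (simp_all add: le total_on_def refl_on_def)
  qed
qed

end

type_synonym ('v, 'a) mpoly = "('v \<Rightarrow>\<^sub>0 nat) \<Rightarrow>\<^sub>0 'a"
type_synonym ('v, 'a) ratfun = "('v indet, 'a) mpoly fract"

definition Const :: "'a::field \<Rightarrow> ('v, 'a) ratfun" where
  "Const c = Fract (Poly_Mapping.single 0 c) 1"

definition Var :: "'v \<Rightarrow> ('v, 'a::field) ratfun" where
  "Var v = Fract (Poly_Mapping.single (Poly_Mapping.single (Indet v) 1) 1) 1"

definition is_subfield :: "'a::field set \<Rightarrow> bool" where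
  "is_subfield F \<longleftrightarrow> 0 \<in> F \<and> 1 \<in> F \<and> (\<forall>x\<in>F. \<forall>y\<in>F. x + y \<in> F \<and> x * y \<in> F)
     \<and> (\<forall>x\<in>F. - x \<in> F \<and> inverse x \<in> F)"

text \<open>
  The field $k(x_v : v \in X)$, for a subfield \<^term>\<open>k\<close> of the type \<^typ>\<open>'a\<close>.
\<close>

definition ratfun_field :: "'a::field set \<Rightarrow> 'v set \<Rightarrow> ('v, 'a) ratfun set" where
  "ratfun_field k X = is_subfield hull (Const ` k \<union> Var ` X)"


section \<open>Evaluation\<close>

text \<open>
  Evaluation of a polynomial, and of a rational function, with \<^term>\<open>a\<close> applied to the
  coefficients. The value of \<^term>\<open>rat_eval\<close> is independent of the choice of the fraction
  if no nonzero polynomial is evaluated to zero.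
\<close>

definition poly_eval :: "('a::zero \<Rightarrow> 'b::comm_semiring_1) \<Rightarrow> ('v \<Rightarrow> 'b) \<Rightarrow> ('v, 'a) mpoly \<Rightarrow> 'b" where
  "poly_eval a x p = (\<Sum>m\<in>Poly_Mapping.keys p. a (Poly_Mapping.lookup p m) *
     (\<Prod>v\<in>Poly_Mapping.keys m. x v ^ Poly_Mapping.lookup m v))"

definition rat_eval :: "('a::field \<Rightarrow> 'b::field) \<Rightarrow> ('v \<Rightarrow> 'b) \<Rightarrow> ('v, 'a) ratfun \<Rightarrow> 'b" where
  "rat_eval a x f = (let (p, q) = (SOME (p, q). q \<noteq> 0 \<and> f = Fract p q)
     in poly_eval a (x \<circ> unindet) p / poly_eval a (x \<circ> unindet) q)"


section \<open>Rationality\<close>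

definition algebraically_independent :: "'a::field set \<Rightarrow> 'a set \<Rightarrow> bool" where
  "algebraically_independent k B \<longleftrightarrow>
     (\<forall>p :: ('a, 'a) mpoly.
        (\<forall>m. Poly_Mapping.lookup p m \<in> k) \<and> (\<forall>m\<in>Poly_Mapping.keys p. Poly_Mapping.keys m \<subseteq> B)
        \<and> poly_eval id id p = 0 \<longrightarrow> p = 0)"

definition finitely_generated_extension :: "'a::field set \<Rightarrow> 'a set \<Rightarrow> bool" where
  "finitely_generated_extension k L \<longleftrightarrow> (\<exists>S. finite S \<and> L = is_subfield hull (k \<union> S))"

definition purely_transcendental :: "'a::field set \<Rightarrow> 'a set \<Rightarrow> bool" where
  "purely_transcendental k L \<longleftrightarrow>
     (\<exists>B. algebraically_independent k B \<and> L = is_subfield hull (k \<union> B))"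

definition rational :: "'a::field set \<Rightarrow> 'a set \<Rightarrow> bool" where
  "rational k L \<longleftrightarrow> finitely_generated_extension k L \<and> purely_transcendental k L"

definition stably_rational :: "'a::field set \<Rightarrow> 'a set \<Rightarrow> bool" where
  "stably_rational k L \<longleftrightarrow> finitely_generated_extension k L \<and>
     (\<exists>m. rational (Const ` k) (ratfun_field L {..<m::nat}))"


section \<open>Groups acting on fields\<close>

text \<open>
  The group of automorphisms of the field \<^term>\<open>F\<close> over \<^term>\<open>k\<close>; that is, Gal(F/k). As for
  \<^const>\<open>BijGroup\<close>, the maps are normalized to be \<^const>\<open>undefined\<close> outside \<^term>\<open>F\<close>.
\<close>

definition field_aut_group :: "'a::field set \<Rightarrow> 'a set \<Rightarrow> ('a \<Rightarrow> 'a) monoid" where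
  "field_aut_group F k = BijGroup F \<lparr>carrier := {\<sigma> \<in> Bij F.
     \<sigma> 1 = 1 \<and> (\<forall>x\<in>F. \<forall>y\<in>F. \<sigma> (x + y) = \<sigma> x + \<sigma> y \<and> \<sigma> (x * y) = \<sigma> x * \<sigma> y)
     \<and> (\<forall>c\<in>k. \<sigma> c = c)}\<rparr>"

definition field_action :: "('g, 'm) monoid_scheme \<Rightarrow> 'a::field set \<Rightarrow> ('g \<Rightarrow> 'a \<Rightarrow> 'a) \<Rightarrow> bool" where
  "field_action G F \<phi> \<longleftrightarrow> \<phi> \<in> hom G (field_aut_group F {})"

definition fixed_field :: "('g, 'm) monoid_scheme \<Rightarrow> 'a set \<Rightarrow> ('g \<Rightarrow> 'a \<Rightarrow> 'a) \<Rightarrow> 'a set" where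
  "fixed_field G F \<phi> = {x \<in> F. \<forall>g\<in>carrier G. \<phi> g x = x}"

definition finite_degree :: "'a::field set \<Rightarrow> 'a set \<Rightarrow> bool" where
  "finite_degree k L \<longleftrightarrow> (\<exists>B. finite B \<and> B \<subseteq> L \<and>
     (\<forall>x\<in>L. \<exists>c. (\<forall>b\<in>B. c b \<in> k) \<and> x = (\<Sum>b\<in>B. c b * b)))"

text \<open>
  The action \<^term>\<open>\<phi>\<close> of \<^term>\<open>G\<close> on $k(x_g : g \in G)$ extends the action \<^term>\<open>\<alpha>\<close>
  on \<^term>\<open>k\<close> and permutes the indeterminates by left translation.
\<close>

definition extends_by_translation ::
  "('g, 'm) monoid_scheme \<Rightarrow> 'a::field set \<Rightarrow> ('g \<Rightarrow> 'a \<Rightarrow> 'a) \<Rightarrow>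
   ('g \<Rightarrow> ('g, 'a) ratfun \<Rightarrow> ('g, 'a) ratfun) \<Rightarrow> bool" where
  "extends_by_translation G k \<alpha> \<phi> \<longleftrightarrow> field_action G (ratfun_field k (carrier G)) \<phi> \<and>
     (\<forall>g\<in>carrier G. \<forall>c\<in>k. \<phi> g (Const c) = Const (\<alpha> g c)) \<and>
     (\<forall>h\<in>carrier G. \<forall>g\<in>carrier G. \<phi> h (Var g) = Var (h \<otimes>\<^bsub>G\<^esub> g))"

text \<open>
  The indeterminates outside the group are fixed here, so that the substitution is injective
  and \<^const>\<open>rat_eval\<close> is a well-defined field homomorphism.
\<close>

definition translation ::
  "('g, 'm) monoid_scheme \<Rightarrow> ('g \<Rightarrow> 'a \<Rightarrow> 'a) \<Rightarrow> 'g \<Rightarrow> ('g, 'a::field) ratfun \<Rightarrow> ('g, 'a) ratfun" where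
  "translation G \<alpha> h =
     rat_eval (Const \<circ> \<alpha> h) (\<lambda>g. Var (if g \<in> carrier G then h \<otimes>\<^bsub>G\<^esub> g else g))"

text \<open>The field $k(H) = k(y(h) : h \in H)^H$.\<close>

definition noether_field :: "'a::field set \<Rightarrow> ('g, 'm) monoid_scheme \<Rightarrow> ('g, 'a) ratfun set" where
  "noether_field k H = fixed_field H (ratfun_field k (carrier H)) (translation H (\<lambda>_ c. c))"

section \<open>Well-definedness of the translation action\<close>

lemma is_subfieldD:
  assumes "is_subfield F"
  shows "0 \<in> F" "1 \<in> F" "x \<in> F \<Longrightarrow> y \<in> F \<Longrightarrow> x + y \<in> F" "x \<in> F \<Longrightarrow> y \<in> F \<Longrightarrow> x * y \<in> F"
    "x \<in> F \<Longrightarrow> - x \<in> F" "x \<in> F \<Longrightarrow> inverse x \<in> F"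
  using assms by (auto simp: is_subfield_def)

lemma is_subfield_hull: "is_subfield (is_subfield hull S)"
  by (rule hull_in) (auto simp: is_subfield_def)

lemma is_subfield_UNIV: "is_subfield UNIV"
  by (simp add: is_subfield_def)

definition field_hom :: "('a::field \<Rightarrow> 'b::field) \<Rightarrow> bool" where
  "field_hom a \<longleftrightarrow> a 1 = 1 \<and> (\<forall>x y. a (x + y) = a x + a y \<and> a (x * y) = a x * a y)"

lemma field_homD:
  assumes "field_hom a"
  shows "a 1 = 1" "a (x + y) = a x + a y" "a (x * y) = a x * a y" "a 0 = 0"
    "a (- x) = - a x" "a (inverse x) = inverse (a x)" "a x = 0 \<longleftrightarrow> x = 0"
proof -
  show 1: "a 1 = 1" and 2: "a (x + y) = a x + a y" and 3: "a (x * y) = a x * a y" for x y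
    using assms by (auto simp: field_hom_def)
  show 0: "a 0 = 0" using 2[of 0 0] by (metis add_0 add_cancel_right_right)
  show "a (- x) = - a x" using 2[of x "- x"] 0 by (simp add: eq_neg_iff_add_eq_0 add.commute)
  show "a x = 0 \<longleftrightarrow> x = 0"
    using 3[of x "inverse x"] 1 0 by (cases "x = 0") auto
  show "a (inverse x) = inverse (a x)"
    using 3[of x "inverse x"] 1 0 by (cases "x = 0") (auto intro: inverse_unique[symmetric])
qed

lemma field_hom_inj: "field_hom a \<Longrightarrow> inj a"
proof (rule injI)
  fix x y assume a: "field_hom a" and "a x = a y"
  then have "a (x + - y) = 0" unfolding field_homD(2)[OF a] field_homD(5)[OF a] by simp
  then show "x = y" unfolding field_homD(7)[OF a] by simp
qed

lemma field_hom_comp: "field_hom a \<Longrightarrow> field_hom b \<Longrightarrow> field_hom (a \<circ> b)"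
  by (simp add: field_hom_def)

lemma field_hom_eq_on_hull:
  assumes "field_hom a" "field_hom b" "\<And>x. x \<in> S \<Longrightarrow> a x = b x" "x \<in> is_subfield hull S"
  shows "a x = b x"
proof -
  have "is_subfield hull S \<subseteq> {x. a x = b x}"
    by (rule hull_minimal)
      (use assms(1-3) in \<open>auto simp: is_subfield_def field_homD[OF assms(1)] field_homD[OF assms(2)]\<close>)
  with assms(4) show ?thesis by auto
qed

lemma field_hom_image_hull:
  assumes "field_hom a" "is_subfield F" "\<And>x. x \<in> S \<Longrightarrow> a x \<in> F" "x \<in> is_subfield hull S"
  shows "a x \<in> F"
proof -
  have "is_subfield hull S \<subseteq> {x. a x \<in> F}"
    by (rule hull_minimal)
      (use assms(3) in \<open>auto simp: is_subfield_def field_homD[OF assms(1)] is_subfieldD[OF assms(2)]\<close>)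
  with assms(4) show ?thesis by auto
qed

lemma field_hom_Const: "field_hom Const"
  by (simp add: field_hom_def Const_def single_add mult_single One_fract_def)

definition mon_eval :: "('v \<Rightarrow> 'b::comm_semiring_1) \<Rightarrow> ('v \<Rightarrow>\<^sub>0 nat) \<Rightarrow> 'b" where
  "mon_eval x m = (\<Prod>v\<in>Poly_Mapping.keys m. x v ^ Poly_Mapping.lookup m v)"

lemma mon_eval_superset:
  "finite V \<Longrightarrow> Poly_Mapping.keys m \<subseteq> V \<Longrightarrow> mon_eval x m = (\<Prod>v\<in>V. x v ^ Poly_Mapping.lookup m v)"
  unfolding mon_eval_def by (rule prod.mono_neutral_left) (auto simp: in_keys_iff)

lemma mon_eval_add: "mon_eval x (m + n) = mon_eval x m * mon_eval x n"
proof -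
  let ?V = "Poly_Mapping.keys m \<union> Poly_Mapping.keys n"
  have "Poly_Mapping.keys (m + n) \<subseteq> ?V" by (rule keys_add)
  then show ?thesis
    by (simp add: mon_eval_superset[of ?V] lookup_add power_add prod.distrib)
qed

lemma poly_eval_mon: "poly_eval a x p = (\<Sum>m\<in>Poly_Mapping.keys p. a (Poly_Mapping.lookup p m) * mon_eval x m)"
  by (simp add: poly_eval_def mon_eval_def)

lemma poly_eval_single:
  assumes "field_hom a"
  shows "poly_eval a x (Poly_Mapping.single m c) = a c * mon_eval x m"
  by (simp add: poly_eval_mon field_homD[OF assms])

lemma poly_eval_add:
  assumes "field_hom a"
  shows "poly_eval a x (p + q) = poly_eval a x p + poly_eval a x q"
  unfolding poly_eval_mon
  by (rule setsum_keys_plus_distrib) (auto simp: field_homD[OF assms] algebra_simps)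

lemma poly_eval_sum:
  assumes "field_hom a"
  shows "poly_eval a x (\<Sum>i\<in>I. f i) = (\<Sum>i\<in>I. poly_eval a x (f i))"
  by (induction I rule: infinite_finite_induct)
    (auto simp: poly_eval_add[OF assms], auto simp: poly_eval_def)

lemma poly_mapping_sum_single:
  "p = (\<Sum>m\<in>Poly_Mapping.keys p. Poly_Mapping.single m (Poly_Mapping.lookup p m))"
  by (rule poly_mapping_eqI) (auto simp: lookup_sum lookup_single when_def in_keys_iff)

lemma poly_eval_mult:
  assumes "field_hom a"
  shows "poly_eval a x (p * q) = poly_eval a x p * poly_eval a x q"
proof -
  have "p * q = (\<Sum>m\<in>Poly_Mapping.keys p. \<Sum>n\<in>Poly_Mapping.keys q.
      Poly_Mapping.single (m + n) (Poly_Mapping.lookup p m * Poly_Mapping.lookup q n))"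
    by (subst (1) poly_mapping_sum_single[of p], subst (1) poly_mapping_sum_single[of q])
      (simp add: sum_product mult_single)
  then have "poly_eval a x (p * q) = (\<Sum>m\<in>Poly_Mapping.keys p. \<Sum>n\<in>Poly_Mapping.keys q.
      a (Poly_Mapping.lookup p m) * a (Poly_Mapping.lookup q n) * (mon_eval x m * mon_eval x n))"
    by (simp add: poly_eval_sum[OF assms] poly_eval_single[OF assms] mon_eval_add field_homD[OF assms])
  then show ?thesis
    by (simp add: poly_eval_mon sum_product mult_ac)
qed

lemma poly_eval_one: "field_hom a \<Longrightarrow> poly_eval a x 1 = 1"
  using poly_eval_single[of a x 0 1] by (simp add: mon_eval_def field_homD)

context
  fixes a :: "'a::field \<Rightarrow> 'b::field" and x :: "'v \<Rightarrow> 'b"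
  assumes hom: "field_hom a"
    and nonzero: "\<And>p. p \<noteq> 0 \<Longrightarrow> poly_eval a (x \<circ> unindet) p \<noteq> 0"
begin

lemma rat_eval_Fract:
  assumes "q \<noteq> 0"
  shows "rat_eval a x (Fract p q) = poly_eval a (x \<circ> unindet) p / poly_eval a (x \<circ> unindet) q"
proof -
  obtain p' q' where pq: "(SOME (p', q'). q' \<noteq> 0 \<and> Fract p q = Fract p' q') = (p', q')"
    by fastforce
  have "case (SOME (p', q'). q' \<noteq> 0 \<and> Fract p q = Fract p' q') of (p', q') \<Rightarrow>
      q' \<noteq> 0 \<and> Fract p q = Fract p' q'"
    by (rule someI[of _ "(p, q)"]) (use assms in auto)
  then have *: "q' \<noteq> 0" "Fract p q = Fract p' q'" by (auto simp: pq)
  then have "p * q' = p' * q" using assms by (simp add: eq_fract)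
  then have "poly_eval a (x \<circ> unindet) (p * q') = poly_eval a (x \<circ> unindet) (p' * q)" by simp
  then show ?thesis
    using nonzero[OF assms] nonzero[OF *(1)]
    by (simp add: rat_eval_def pq poly_eval_mult[OF hom] divide_simps)
qed

lemma field_hom_rat_eval: "field_hom (rat_eval a x)"
  unfolding field_hom_def
proof (intro conjI allI)
  show "rat_eval a x 1 = 1"
    by (simp add: One_fract_def rat_eval_Fract poly_eval_one[OF hom])
next
  fix f g :: "('v, 'a) ratfun"
  obtain p q where f: "f = Fract p q" "q \<noteq> 0" by (cases f)
  obtain r s where g: "g = Fract r s" "s \<noteq> 0" by (cases g)
  note nz = nonzero[OF f(2)] nonzero[OF g(2)]
  show "rat_eval a x (f + g) = rat_eval a x f + rat_eval a x g"
    using f g nz by (simp add: rat_eval_Fract poly_eval_add[OF hom] poly_eval_mult[OF hom] field_simps)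
  show "rat_eval a x (f * g) = rat_eval a x f * rat_eval a x g"
    using f g nz by (simp add: rat_eval_Fract poly_eval_mult[OF hom])
qed

lemma rat_eval_Const: "rat_eval a x (Const c) = a c"
  by (simp add: Const_def rat_eval_Fract poly_eval_one[OF hom] poly_eval_single[OF hom] mon_eval_def)

lemma rat_eval_Var: "rat_eval a x (Var v) = x v"
  by (simp add: Var_def rat_eval_Fract poly_eval_one[OF hom] poly_eval_single[OF hom] mon_eval_def
      field_homD[OF hom])

end

lemma Fract_sum: "Fract (\<Sum>i\<in>I. f i) 1 = (\<Sum>i\<in>I. Fract (f i) (1::'a::idom))"
proof (induction I rule: infinite_finite_induct)
  case (insert i I)
  have "Fract (f i + sum f I) (1::'a) = Fract (f i) 1 + Fract (sum f I) 1" by simp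
  with insert show ?case by simp
qed (auto simp: Zero_fract_def)

lemma mon_eval_Var:
  "mon_eval (\<lambda>v. Var (\<pi> v)) m = (Fract (Poly_Mapping.single
     (\<Sum>v\<in>Poly_Mapping.keys m. Poly_Mapping.single (Indet (\<pi> v)) (Poly_Mapping.lookup m v)) 1) 1
     :: ('v, 'a::field) ratfun)"
proof -
  have pow: "(Var w :: ('v, 'a) ratfun) ^ n =
      Fract (Poly_Mapping.single (Poly_Mapping.single (Indet w) n) 1) 1" for w n
    by (induction n) (auto simp: Var_def mult_single One_fract_def simp flip: single_add)
  have "(\<Prod>v\<in>V. (Var (\<pi> v) :: ('v, 'a) ratfun) ^ Poly_Mapping.lookup m v) =
      Fract (Poly_Mapping.single (\<Sum>v\<in>V. Poly_Mapping.single (Indet (\<pi> v)) (Poly_Mapping.lookup m v)) 1) 1"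
    for V
    by (induction V rule: infinite_finite_induct) (auto simp: pow mult_single One_fract_def)
  then show ?thesis by (simp add: mon_eval_def)
qed

lemma poly_eval_Var_nonzero:
  fixes s :: "'a::field \<Rightarrow> 'a" and \<pi> :: "'v \<Rightarrow> 'v"
  assumes s: "field_hom s" and \<pi>: "inj \<pi>" and p: "p \<noteq> 0"
  shows "poly_eval (Const \<circ> s) ((\<lambda>v. Var (\<pi> v)) \<circ> unindet) p \<noteq> (0 :: ('v, 'a) ratfun)"
proof -
  define R where "R m = (\<Sum>v\<in>Poly_Mapping.keys m.
      Poly_Mapping.single (Indet (\<pi> (unindet v))) (Poly_Mapping.lookup m v :: nat))" for m
  have "Poly_Mapping.lookup (R m) (Indet (\<pi> (unindet v))) = Poly_Mapping.lookup m v" for m v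
  proof -
    have "Indet (\<pi> (unindet u)) = Indet (\<pi> (unindet v)) \<longleftrightarrow> u = v" for u
      using \<pi> by (auto simp: inj_eq indet.expand)
    then show ?thesis
      by (simp add: R_def lookup_sum lookup_single when_def in_keys_iff)
  qed
  then have R: "inj R" by (intro injI poly_mapping_eqI) metis
  define P where "P = (\<Sum>m\<in>Poly_Mapping.keys p. Poly_Mapping.single (R m) (s (Poly_Mapping.lookup p m)))"
  have "poly_eval (Const \<circ> s) ((\<lambda>v. Var (\<pi> v)) \<circ> unindet) p = (Fract P 1 :: ('v, 'a) ratfun)"
    by (simp add: poly_eval_mon P_def R_def Fract_sum Const_def o_def mult_single mon_eval_Var)
  moreover have "P \<noteq> 0"
  proof -
    from p obtain m where m: "m \<in> Poly_Mapping.keys p"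
      by (metis all_not_in_conv keys_eq_empty)
    have "Poly_Mapping.lookup P (R m) = s (Poly_Mapping.lookup p m)"
      using R m by (simp add: P_def lookup_sum lookup_single when_def inj_eq)
    with m show ?thesis by (auto simp: field_homD[OF s] in_keys_iff)
  qed
  ultimately show ?thesis by (simp add: Zero_fract_def eq_fract)
qed

lemma ratfun_field_gens:
  "c \<in> k \<Longrightarrow> Const c \<in> ratfun_field k X" "v \<in> X \<Longrightarrow> Var v \<in> ratfun_field k X"
  unfolding ratfun_field_def by (auto intro: hull_inc)

context group
begin

lemma translation_props:
  assumes "field_hom (\<alpha> h)" "h \<in> carrier G"
  shows "field_hom (translation G \<alpha> h)" "translation G \<alpha> h (Const c) = Const (\<alpha> h c)"
    "g \<in> carrier G \<Longrightarrow> translation G \<alpha> h (Var g) = Var (h \<otimes> g)"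
proof -
  let ?\<pi> = "\<lambda>g. if g \<in> carrier G then h \<otimes> g else g"
  have "inj ?\<pi>" using assms(2) by (auto intro!: injI split: if_splits)
  note nz = poly_eval_Var_nonzero[OF assms(1) this]
  have hom: "field_hom (Const \<circ> \<alpha> h :: _ \<Rightarrow> ('a, _) ratfun)"
    by (rule field_hom_comp[OF field_hom_Const assms(1)])
  show "field_hom (translation G \<alpha> h)"
    unfolding translation_def by (rule field_hom_rat_eval[OF hom nz])
  show "translation G \<alpha> h (Const c) = Const (\<alpha> h c)"
    unfolding translation_def by (subst rat_eval_Const[OF hom nz]) auto
  show "g \<in> carrier G \<Longrightarrow> translation G \<alpha> h (Var g) = Var (h \<otimes> g)"
    unfolding translation_def by (subst rat_eval_Var[OF hom nz]) auto
qed

theorem extends_by_translation_translation: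
  assumes hom: "\<And>g. g \<in> carrier G \<Longrightarrow> field_hom (\<alpha> g)"
    and closed: "\<And>g c. g \<in> carrier G \<Longrightarrow> c \<in> k \<Longrightarrow> \<alpha> g c \<in> k"
    and one: "\<And>c. c \<in> k \<Longrightarrow> \<alpha> \<one> c = c"
    and mult: "\<And>g h c. g \<in> carrier G \<Longrightarrow> h \<in> carrier G \<Longrightarrow> c \<in> k \<Longrightarrow> \<alpha> (g \<otimes> h) c = \<alpha> g (\<alpha> h c)"
  shows "extends_by_translation G k \<alpha> (\<lambda>g. restrict (translation G \<alpha> g) (ratfun_field k (carrier G)))"
proof -
  let ?F = "ratfun_field k (carrier G)" and ?T = "translation G \<alpha>"
  have T: "field_hom (?T h)" "?T h (Const c) = Const (\<alpha> h c)"
    "g \<in> carrier G \<Longrightarrow> ?T h (Var g) = Var (h \<otimes> g)" if "h \<in> carrier G" for h g c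
    using translation_props[of \<alpha> h, OF hom[OF that] that] by auto
  have F: "is_subfield ?F" unfolding ratfun_field_def by (rule is_subfield_hull)
  have closedT: "?T g f \<in> ?F" if "g \<in> carrier G" "f \<in> ?F" for g f
    using that(2) unfolding ratfun_field_def
    by (rule field_hom_image_hull[OF T(1)[OF that(1)] is_subfield_hull, rotated])
      (use that(1) in \<open>auto simp: T closed intro!: ratfun_field_gens[unfolded ratfun_field_def]\<close>)
  have multT: "?T (g \<otimes> h) f = ?T g (?T h f)" if "g \<in> carrier G" "h \<in> carrier G" "f \<in> ?F" for g h f
  proof -
    have hom': "field_hom (?T (g \<otimes> h))" "field_hom (?T g \<circ> ?T h)"
      using that(1,2) by (simp_all add: T(1) field_hom_comp)
    have "?T (g \<otimes> h) f = (?T g \<circ> ?T h) f"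
      using that(3) unfolding ratfun_field_def
      by (rule field_hom_eq_on_hull[OF hom', rotated])
        (use that(1,2) in \<open>auto simp: T mult m_assoc\<close>)
    then show ?thesis by simp
  qed
  have oneT: "?T \<one> f = f" if "f \<in> ?F" for f
  proof -
    have hom': "field_hom (?T \<one>)" "field_hom (id :: ('a, 'c) ratfun \<Rightarrow> _)"
      by (simp_all add: T(1) field_hom_def[of id])
    have "?T \<one> f = id f"
      using that unfolding ratfun_field_def
      by (rule field_hom_eq_on_hull[OF hom', rotated]) (auto simp: T one)
    then show ?thesis by simp
  qed
  have "bij_betw (?T g) ?F ?F" if "g \<in> carrier G" for g
    by (rule bij_betw_byWitness[where f' = "?T (inv g)"])
      (use that in \<open>auto simp: closedT oneT simp flip: multT\<close>)
  then have Bij: "restrict (?T g) ?F \<in> Bij ?F" if "g \<in> carrier G" for g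
    using that by (auto simp: Bij_def cong: bij_betw_cong)
  have "field_action G ?F (\<lambda>g. restrict (?T g) ?F)"
    unfolding field_action_def
  proof (rule homI)
    fix g assume g: "g \<in> carrier G"
    show "restrict (?T g) ?F \<in> carrier (field_aut_group ?F {})"
      using g by (auto simp: field_aut_group_def Bij is_subfieldD[OF F] field_homD[OF T(1)])
    fix h assume h: "h \<in> carrier G"
    show "restrict (?T (g \<otimes> h)) ?F =
        restrict (?T g) ?F \<otimes>\<^bsub>field_aut_group ?F {}\<^esub> restrict (?T h) ?F"
      using g h by (auto simp: field_aut_group_def BijGroup_def Bij compose_def multT closedT fun_eq_iff)
  qed
  then show ?thesis
    by (auto simp: extends_by_translation_def T ratfun_field_gens)
qed

end

lemma noether_field_action:
  assumes "group H"
  shows "extends_by_translation H k (\<lambda>_ c. c)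
    (\<lambda>h. restrict (translation H (\<lambda>_ c. c) h) (ratfun_field k (carrier H)))"
  by (rule group.extends_by_translation_translation[OF assms, where \<alpha> = "\<lambda>_ c. c"])
    (simp_all add: field_hom_def)

end

theory Submission
  imports
    Defs
    "HOL-Computational_Algebra.Polynomial"
    "HOL-Algebra.Multiplicative_Group"
begin

text \<open>
  Choose \<open>\<theta> \<in> K\<close> with pairwise distinct conjugates under \<open>G2\<close>, and put
  \<open>z (h, j) = \<Sum>g\<in>G2. (g \<theta>) ^ j * x (h, g)\<close>. As Vandermonde matrices are invertible, the
  \<open>z (h, j)\<close> with \<open>j < card G2\<close> are again independent generators of the rational function field over \<open>K\<close>; they
  are fixed by \<open>G2\<close> and permuted by \<open>G1\<close> through \<open>h\<close>. Write \<open>y h = z (h, 0)\<close> and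
  \<open>L = K(y h : h \<in> G1)\<close>. A second Vandermonde substitution, with the nodes \<open>y h \<in> L\<close>, replaces
  the \<open>z (h, j)\<close> with \<open>j \<ge> 1\<close> by the \<open>G\<close>-invariant \<open>t (j, i) = \<Sum>h\<in>G1. y h ^ i * z (h, j)\<close>.
  So the whole field is \<open>L(t)\<close> with \<open>t\<close> invariant and algebraically independent over \<open>L\<close>. Its fixed
  field is therefore \<open>L^G(t)\<close>, and \<open>L^G = k(y h : h \<in> G1)^G1\<close> is a copy of \<open>k(G1)\<close>.
\<close>

section \<open>Polynomials over subrings\<close>

text \<open>Both substitutions give invariants for the same reason: a group translates the nodes and
  the linear forms simultaneously, so a power-weighted sum is merely reindexed. They make explicit
  the invariant basis that Galois descent would provide for a semilinear action, at the price of
  needing pairwise distinct nodes. Over \<open>L\<close> these come for free, since the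
  \<open>y h\<close> are independent; in K they amount to a primitive element over k, and
  \<open>G2\<close> acts faithfully on K because the kernel is \<open>G1\<close>. The passage from
  \<open>L(t)^G\<close> to \<open>L^G(t)\<close> compares coefficients after the denominator has
  been replaced by its norm. The same argument for \<open>G2\<close> acting on \<open>K(y)\<close>
  yields \<open>k(y)\<close>, on which \<open>G1\<close> permutes the \<open>y h\<close> and fixes
  k: this is the action that defines \<open>k(G1)\<close>. The converse ends with stable rationality
  because what is known to be rational is \<open>k(G1)(t)\<close> and not \<open>k(G1)\<close>
  itself. All fields are subsets of types and involve different sets of indeterminates; therefore
  homomorphisms are considered on subsets, and rationality is transported along them.\<close>

definition subring_set :: "'a::comm_ring_1 set \<Rightarrow> bool" where
  "subring_set R \<longleftrightarrow> 0 \<in> R \<and> 1 \<in> R \<and> (\<forall>x\<in>R. \<forall>y\<in>R. x + y \<in> R \<and> x * y \<in> R) \<and> (\<forall>x\<in>R. - x \<in> R)"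

lemma subring_setD:
  assumes "subring_set R"
  shows "0 \<in> R" "1 \<in> R" "x \<in> R \<Longrightarrow> y \<in> R \<Longrightarrow> x + y \<in> R" "x \<in> R \<Longrightarrow> y \<in> R \<Longrightarrow> x * y \<in> R"
    "x \<in> R \<Longrightarrow> - x \<in> R" "x \<in> R \<Longrightarrow> y \<in> R \<Longrightarrow> x - y \<in> R"
proof -
  show "x - y \<in> R" if "x \<in> R" "y \<in> R"
    using assms that unfolding subring_set_def by (metis diff_conv_add_uminus)
qed (use assms in \<open>auto simp: subring_set_def\<close>)

lemma subring_set_sum: "subring_set R \<Longrightarrow> (\<And>i. i \<in> I \<Longrightarrow> f i \<in> R) \<Longrightarrow> sum f I \<in> R"
  by (induction I rule: infinite_finite_induct) (auto simp: subring_setD)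

lemma subring_set_prod: "subring_set R \<Longrightarrow> (\<And>i. i \<in> I \<Longrightarrow> f i \<in> R) \<Longrightarrow> prod f I \<in> R"
  by (induction I rule: infinite_finite_induct) (auto simp: subring_setD)

lemma subring_set_power: "subring_set R \<Longrightarrow> x \<in> R \<Longrightarrow> x ^ n \<in> R"
  by (induction n) (auto simp: subring_setD)

lemma subring_set_UNIV [simp]: "subring_set UNIV"
  by (simp add: subring_set_def)

lemma is_subfield_subring: "is_subfield F \<Longrightarrow> subring_set F"
  by (simp add: is_subfield_def subring_set_def)

lemma is_subfield_hull_subring: "subring_set (is_subfield hull S)"
  by (rule is_subfield_subring[OF is_subfield_hull])

lemma is_subfield_divide: "is_subfield F \<Longrightarrow> x \<in> F \<Longrightarrow> y \<in> F \<Longrightarrow> x / y \<in> F"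
  by (simp add: divide_inverse is_subfieldD)

text \<open>The maps of a group action are \<open>undefined\<close> outside their field, and maps
  built by extension are specified only on a generated subfield, so the laws are asked on
  \<open>R\<close> alone. Compatibility with zero and negation follows from additivity when
  \<open>R\<close> is a subring.\<close>

definition hom_on :: "'a::comm_ring_1 set \<Rightarrow> ('a \<Rightarrow> 'b::comm_ring_1) \<Rightarrow> bool" where
  "hom_on R a \<longleftrightarrow> a 1 = 1 \<and> (\<forall>x\<in>R. \<forall>y\<in>R. a (x + y) = a x + a y \<and> a (x * y) = a x * a y)"

lemma hom_on_subset: "hom_on R a \<Longrightarrow> S \<subseteq> R \<Longrightarrow> hom_on S a"
  by (auto simp: hom_on_def)

lemma hom_on_id [simp]: "hom_on R id" "hom_on R (\<lambda>x. x)"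
  by (simp_all add: hom_on_def)

lemma hom_on_comp: "hom_on R a \<Longrightarrow> hom_on S b \<Longrightarrow> a ` R \<subseteq> S \<Longrightarrow> hom_on R (b \<circ> a)"
  by (simp add: hom_on_def image_subset_iff)

lemma hom_on_field_hom: "field_hom a \<Longrightarrow> hom_on R a"
  by (simp add: hom_on_def field_hom_def)

context
  fixes R :: "'a::comm_ring_1 set" and a :: "'a \<Rightarrow> 'b::comm_ring_1"
  assumes R: "subring_set R" and a: "hom_on R a"
begin

lemma hom_on_0: "a 0 = 0"
  using a subring_setD(1)[OF R] unfolding hom_on_def by (metis add_0 add_cancel_right_right)

lemma hom_on_minus: "x \<in> R \<Longrightarrow> a (- x) = - a x"
  using a subring_setD(5)[OF R, of x] hom_on_0 unfolding hom_on_def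
  by (metis add.right_inverse eq_neg_iff_add_eq_0 add.commute)

lemma hom_on_sum: "(\<And>i. i \<in> I \<Longrightarrow> f i \<in> R) \<Longrightarrow> a (sum f I) = (\<Sum>i\<in>I. a (f i))"
  by (induction I rule: infinite_finite_induct)
    (use a in \<open>auto simp: hom_on_0 hom_on_def subring_set_sum[OF R]\<close>)

lemma hom_on_prod: "(\<And>i. i \<in> I \<Longrightarrow> f i \<in> R) \<Longrightarrow> a (prod f I) = (\<Prod>i\<in>I. a (f i))"
  by (induction I rule: infinite_finite_induct)
    (use a in \<open>auto simp: hom_on_0 hom_on_def subring_set_prod[OF R]\<close>)

lemma hom_on_power: "x \<in> R \<Longrightarrow> a (x ^ n) = a x ^ n"
  by (induction n) (use a in \<open>auto simp: hom_on_def subring_set_power[OF R]\<close>)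

lemma hom_on_image_subring: "subring_set (a ` R)"
  unfolding subring_set_def
proof (intro conjI ballI)
  show "0 \<in> a ` R" "1 \<in> a ` R"
    using hom_on_0 a subring_setD(1,2)[OF R] unfolding hom_on_def by (metis imageI)+
next
  fix x y assume "x \<in> a ` R" "y \<in> a ` R"
  then obtain u v where "x = a u" "y = a v" "u \<in> R" "v \<in> R" by auto
  then show "x + y \<in> a ` R" "x * y \<in> a ` R"
    using a subring_setD(3,4)[OF R, of u v] unfolding hom_on_def by (metis imageI)+
next
  fix x assume "x \<in> a ` R"
  then obtain u where "x = a u" "u \<in> R" by auto
  then show "- x \<in> a ` R" 
    using hom_on_minus[of u] subring_setD(5)[OF R, of u] by (metis imageI)
qed

lemma hom_on_mon_eval:
  "(\<And>v. v \<in> Poly_Mapping.keys m \<Longrightarrow> x v \<in> R) \<Longrightarrow> a (mon_eval x m) = mon_eval (a \<circ> x) m"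
  by (simp add: mon_eval_def hom_on_prod hom_on_power subring_set_power[OF R])

end

lemma subring_set_mon_eval:
  "subring_set R \<Longrightarrow> (\<And>v. v \<in> Poly_Mapping.keys m \<Longrightarrow> x v \<in> R) \<Longrightarrow> mon_eval x m \<in> R"
  by (simp add: mon_eval_def subring_set_prod subring_set_power)

section \<open>Polynomials with coefficients in a subring and indeterminates in a subset\<close>

definition polys_over :: "'a::zero set \<Rightarrow> 'v set \<Rightarrow> ('v, 'a) mpoly set" where
  "polys_over R X = {p. (\<forall>m. Poly_Mapping.lookup p m \<in> R) \<and>
     (\<forall>m\<in>Poly_Mapping.keys p. Poly_Mapping.keys m \<subseteq> X)}"

definition PConst :: "'a::zero \<Rightarrow> ('v, 'a) mpoly" where
  "PConst c = Poly_Mapping.single 0 c"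

definition PVar :: "'v \<Rightarrow> ('v, 'a::zero_neq_one) mpoly" where
  "PVar v = Poly_Mapping.single (Poly_Mapping.single v 1) 1"

lemma PConst_0 [simp]: "PConst 0 = 0"
  by (simp add: PConst_def)

lemma PConst_1: "PConst 1 = (1 :: ('v, 'a::comm_ring_1) mpoly)"
  by (simp add: PConst_def)

lemma PConst_mult: "PConst (x * y) = PConst x * PConst (y::'a::comm_ring_1)"
  by (simp add: PConst_def mult_single)

lemma polys_over_mono: "R \<subseteq> S \<Longrightarrow> X \<subseteq> Y \<Longrightarrow> polys_over R X \<subseteq> polys_over S Y"
  by (fastforce simp: polys_over_def)

lemma polys_over_UNIV [simp]: "polys_over UNIV UNIV = UNIV"
  by (simp add: polys_over_def)

lemma polys_over_single:
  "c \<in> R \<Longrightarrow> 0 \<in> R \<Longrightarrow> Poly_Mapping.keys m \<subseteq> X \<Longrightarrow> Poly_Mapping.single m c \<in> polys_over R X"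
  by (auto simp: polys_over_def lookup_single when_def split: if_splits)

lemma PConst_in: "c \<in> R \<Longrightarrow> 0 \<in> R \<Longrightarrow> PConst c \<in> polys_over R X"
  by (simp add: PConst_def polys_over_single)

lemma PVar_in: "0 \<in> R \<Longrightarrow> 1 \<in> R \<Longrightarrow> v \<in> X \<Longrightarrow> PVar v \<in> polys_over R X"
  by (simp add: PVar_def polys_over_single)

lemma mult_sum_single:
  "p * q = (\<Sum>m\<in>Poly_Mapping.keys p. \<Sum>n\<in>Poly_Mapping.keys q.
      Poly_Mapping.single (m + n) (Poly_Mapping.lookup p m * Poly_Mapping.lookup q n))"
  for p q :: "'v::monoid_add \<Rightarrow>\<^sub>0 'a::comm_ring_1"
    by (subst (1) poly_mapping_sum_single[of p], subst (1) poly_mapping_sum_single[of q])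
      (simp add: sum_product mult_single)

lemma subring_set_polys_over:
  assumes R: "subring_set R"
  shows "subring_set (polys_over R X)"
  unfolding subring_set_def
proof (intro conjI ballI)
  show "0 \<in> polys_over R X" by (simp add: polys_over_def subring_setD[OF R])
  show "1 \<in> polys_over R X"
    using polys_over_single[of 1 R 0 X] by (simp add: subring_setD[OF R])
next
  fix p q assume p: "p \<in> polys_over R X" and q: "q \<in> polys_over R X"
  show add: "p + q \<in> polys_over R X" if "p \<in> polys_over R X" "q \<in> polys_over R X" for p q
    using that keys_add[of p q] by (fastforce simp: polys_over_def lookup_add subring_setD[OF R])
  have sum: "sum f I \<in> polys_over R X" if "\<And>i. i \<in> I \<Longrightarrow> f i \<in> polys_over R X"
    for f :: "'c \<Rightarrow> ('b, 'a) mpoly" and I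
    using that by (induction I rule: infinite_finite_induct)
      (auto simp: add, auto simp: polys_over_def subring_setD[OF R])
  note mult_sum_single[of p q]
  also have "(\<Sum>m\<in>Poly_Mapping.keys p. \<Sum>n\<in>Poly_Mapping.keys q.
      Poly_Mapping.single (m + n) (Poly_Mapping.lookup p m * Poly_Mapping.lookup q n)) \<in> polys_over R X"
  proof (intro sum polys_over_single)
    fix m n assume mn: "m \<in> Poly_Mapping.keys p" "n \<in> Poly_Mapping.keys q"
    show "Poly_Mapping.keys (m + n) \<subseteq> X"
      using keys_add[of m n] p q mn by (fastforce simp: polys_over_def)
    show "Poly_Mapping.lookup p m * Poly_Mapping.lookup q n \<in> R" "0 \<in> R"
      using p q by (auto simp: polys_over_def subring_setD[OF R])
  qed
  finally show "p * q \<in> polys_over R X" .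
next
  fix p assume "p \<in> polys_over R X"
  then show "- p \<in> polys_over R X" by (auto simp: polys_over_def subring_setD[OF R] in_keys_iff)
qed


lemma poly_eval_superset:
  assumes "a 0 = 0" "finite M" "Poly_Mapping.keys p \<subseteq> M"
  shows "poly_eval a x p = (\<Sum>m\<in>M. a (Poly_Mapping.lookup p m) * mon_eval x m)"
  unfolding poly_eval_mon
  by (rule sum.mono_neutral_left) (use assms in \<open>auto simp: in_keys_iff\<close>)

lemma poly_eval_cong:
  assumes "p \<in> polys_over R X" "\<And>c. c \<in> R \<Longrightarrow> a c = b c" "\<And>v. v \<in> X \<Longrightarrow> x v = y v"
  shows "poly_eval a x p = poly_eval b y p"
  unfolding poly_eval_def
  by (intro sum.cong prod.cong arg_cong2[where f="(*)"] arg_cong2[where f="(^)"])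
    (use assms in \<open>auto simp: polys_over_def dest!: bspec\<close>)

lemma poly_eval_PConst: "a 0 = 0 \<Longrightarrow> poly_eval a x (PConst c) = a c"
  by (simp add: PConst_def poly_eval_mon mon_eval_def)

lemma poly_eval_PVar: "a 1 = 1 \<Longrightarrow> poly_eval a x (PVar v) = x v"
  by (simp add: PVar_def poly_eval_mon mon_eval_def)

lemma mon_eval_PVar: "mon_eval PVar m = (Poly_Mapping.single m 1 :: ('v, 'a::comm_ring_1) mpoly)"
proof -
  have pow: "(PVar w :: ('v, 'a) mpoly) ^ n = Poly_Mapping.single (Poly_Mapping.single w n) 1" for w :: 'v and n
    by (induction n) (auto simp: PVar_def mult_single simp flip: single_add)
  have "(\<Prod>v\<in>V. (PVar v :: ('v, 'a) mpoly) ^ Poly_Mapping.lookup m v) =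
      Poly_Mapping.single (\<Sum>v\<in>V. Poly_Mapping.single v (Poly_Mapping.lookup m v)) 1" for V and m :: "'v \<Rightarrow>\<^sub>0 nat"
    by (induction V rule: infinite_finite_induct) (auto simp: pow mult_single)
  then show ?thesis
    by (simp add: mon_eval_def flip: poly_mapping_sum_single)
qed

text \<open>Substitution arguments end here: a composite of evaluations that restores every
  coefficient and every indeterminate is the identity on polynomials.\<close>

lemma poly_eval_PConst_PVar: "poly_eval PConst PVar p = (p :: ('v, 'a::comm_ring_1) mpoly)"
  by (simp add: poly_eval_mon mon_eval_PVar PConst_def mult_single flip: poly_mapping_sum_single)

lemma hom_on_PConst: "hom_on R PConst"
  by (simp add: hom_on_def PConst_def single_add mult_single)

context
  fixes R :: "'a::comm_ring_1 set" and a :: "'a \<Rightarrow> 'b::comm_ring_1" and x :: "'v \<Rightarrow> 'b"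
  assumes R: "subring_set R" and a: "hom_on R a"
begin

text \<open>Unlike \<open>poly_eval_add\<close>, this allows a coefficient map that is a
  homomorphism only on \<open>R\<close>, and coefficients that are themselves polynomials.\<close>

lemma poly_eval_add_on:
  assumes "p \<in> polys_over R X" "q \<in> polys_over R X"
  shows "poly_eval a x (p + q) = poly_eval a x p + poly_eval a x q"
proof -
  let ?M = "Poly_Mapping.keys p \<union> Poly_Mapping.keys q"
  note * = poly_eval_superset[of a ?M, OF hom_on_0[OF R a]]
  have "a (Poly_Mapping.lookup p m + Poly_Mapping.lookup q m) =
      a (Poly_Mapping.lookup p m) + a (Poly_Mapping.lookup q m)" for m
    using a assms by (simp add: hom_on_def polys_over_def)
  then show ?thesis
    by (simp add: * keys_add lookup_add sum.distrib distrib_right)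
qed

lemma poly_eval_sum_on:
  "(\<And>i. i \<in> I \<Longrightarrow> f i \<in> polys_over R X) \<Longrightarrow> poly_eval a x (sum f I) = (\<Sum>i\<in>I. poly_eval a x (f i))"
  by (induction I rule: infinite_finite_induct)
    (auto simp: poly_eval_add_on[of _ X] subring_set_sum subring_set_polys_over R, auto simp: poly_eval_def)

lemma poly_eval_mult_on:
  assumes p: "p \<in> polys_over R X" and q: "q \<in> polys_over R X"
  shows "poly_eval a x (p * q) = poly_eval a x p * poly_eval a x q"
proof -
  have in_R: "Poly_Mapping.lookup p m \<in> R" "Poly_Mapping.lookup q m \<in> R" for m
    using p q by (auto simp: polys_over_def)
  have single: "Poly_Mapping.single (m + n) (Poly_Mapping.lookup p m * Poly_Mapping.lookup q n)
      \<in> polys_over R UNIV" for m n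
    by (rule polys_over_single) (auto simp: subring_setD[OF R] in_R)
  have "poly_eval a x (p * q) = (\<Sum>m\<in>Poly_Mapping.keys p. \<Sum>n\<in>Poly_Mapping.keys q.
      poly_eval a x (Poly_Mapping.single (m + n) (Poly_Mapping.lookup p m * Poly_Mapping.lookup q n)))"
    unfolding mult_sum_single[of p q]
    by (subst poly_eval_sum_on[of _ _ UNIV] | intro sum.cong refl subring_set_sum subring_set_polys_over R single)+
  also have "\<dots> = (\<Sum>m\<in>Poly_Mapping.keys p. \<Sum>n\<in>Poly_Mapping.keys q.
      a (Poly_Mapping.lookup p m) * a (Poly_Mapping.lookup q n) * (mon_eval x m * mon_eval x n))"
  proof (intro sum.cong refl)
    fix m n
    have "a (Poly_Mapping.lookup p m * Poly_Mapping.lookup q n) =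
        a (Poly_Mapping.lookup p m) * a (Poly_Mapping.lookup q n)"
      using a in_R by (simp add: hom_on_def)
    then show "poly_eval a x (Poly_Mapping.single (m + n) (Poly_Mapping.lookup p m * Poly_Mapping.lookup q n)) =
        a (Poly_Mapping.lookup p m) * a (Poly_Mapping.lookup q n) * (mon_eval x m * mon_eval x n)"
      by (auto simp: poly_eval_mon mon_eval_add hom_on_0[OF R a])
  qed
  finally show ?thesis
    by (simp add: poly_eval_mon sum_product mult_ac)
qed

lemma hom_on_poly_eval: "hom_on (polys_over R X) (poly_eval a x)"
  using a poly_eval_PConst[of a x 1] poly_eval_add_on poly_eval_mult_on
  by (auto simp: hom_on_def hom_on_0[OF R a] PConst_def)

end

lemma poly_eval_in:
  fixes a :: "'a::comm_ring_1 \<Rightarrow> 'b::comm_ring_1"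
  assumes "p \<in> polys_over R X" "subring_set S" "\<And>c. c \<in> R \<Longrightarrow> a c \<in> S" "\<And>v. v \<in> X \<Longrightarrow> x v \<in> S"
  shows "poly_eval a x p \<in> S"
  unfolding poly_eval_mon
  by (intro subring_set_sum subring_setD(4) subring_set_mon_eval assms(2-4))
    (use assms(1) in \<open>auto simp: polys_over_def\<close>)

text \<open>The standard way to compute a composite substitution: push \<open>h\<close> through the
  evaluation, then identify the resulting coefficient map and values by
  \<open>poly_eval_cong\<close>.\<close>

lemma hom_on_poly_eval_comp:
  assumes "subring_set S" "hom_on S h" "p \<in> polys_over R X"
    "\<And>c. c \<in> R \<Longrightarrow> a c \<in> S" "\<And>v. v \<in> X \<Longrightarrow> x v \<in> S"
  shows "h (poly_eval a x p) = poly_eval (h \<circ> a) (h \<circ> x) p"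
proof -
  have *: "Poly_Mapping.lookup p m \<in> R" "m \<in> Poly_Mapping.keys p \<Longrightarrow> Poly_Mapping.keys m \<subseteq> X" for m
    using assms(3) by (auto simp: polys_over_def)
  have mon: "mon_eval x m \<in> S" "h (mon_eval x m) = mon_eval (h \<circ> x) m"
    if "m \<in> Poly_Mapping.keys p" for m
    using *(2)[OF that] assms(5)
    by (auto intro!: subring_set_mon_eval hom_on_mon_eval assms(1,2))
  have "h (poly_eval a x p) = (\<Sum>m\<in>Poly_Mapping.keys p. h (a (Poly_Mapping.lookup p m) * mon_eval x m))"
    unfolding poly_eval_mon
    by (intro hom_on_sum[OF assms(1,2)] subring_setD(4)[OF assms(1)] mon assms(4) *)
  also have "\<dots> = (\<Sum>m\<in>Poly_Mapping.keys p. h (a (Poly_Mapping.lookup p m)) * h (mon_eval x m))"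
    by (intro sum.cong refl) (use assms(2,4) * mon in \<open>auto simp: hom_on_def\<close>)
  also have "\<dots> = poly_eval (h \<circ> a) (h \<circ> x) p"
    by (auto simp: poly_eval_mon mon)
  finally show ?thesis .
qed

section \<open>Homomorphisms on subfields\<close>

context
  fixes F :: "'a::field set" and \<sigma> :: "'a \<Rightarrow> 'b::field"
  assumes F: "is_subfield F" and \<sigma>: "hom_on F \<sigma>"
begin

lemma hom_on_mult_inverse: "x \<in> F \<Longrightarrow> x \<noteq> 0 \<Longrightarrow> \<sigma> x * \<sigma> (inverse x) = 1"
  using \<sigma> is_subfieldD(6)[OF F, of x] unfolding hom_on_def by (metis right_inverse)

lemma hom_on_eq_0: "x \<in> F \<Longrightarrow> \<sigma> x = 0 \<longleftrightarrow> x = 0"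
  using hom_on_mult_inverse hom_on_0[OF is_subfield_subring[OF F] \<sigma>]
  by (metis mult_zero_left zero_neq_one)

lemma hom_on_inverse: "x \<in> F \<Longrightarrow> \<sigma> (inverse x) = inverse (\<sigma> x)"
  using hom_on_mult_inverse hom_on_0[OF is_subfield_subring[OF F] \<sigma>]
  by (cases "x = 0") (auto intro: inverse_unique[symmetric])

lemma hom_on_inj: "inj_on \<sigma> F"
proof (rule inj_onI)
  fix x y assume xy: "x \<in> F" "y \<in> F" "\<sigma> x = \<sigma> y"
  then have "\<sigma> (x + - y) = \<sigma> x + - \<sigma> y"
    using \<sigma> is_subfieldD(5)[OF F, of y] hom_on_minus[OF is_subfield_subring[OF F] \<sigma>, of y]
    unfolding hom_on_def by metis
  then show "x = y"
    using xy hom_on_eq_0[of "x + - y"] by (simp add: subring_setD[OF is_subfield_subring[OF F]])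
qed

lemma hom_on_image_subfield: "is_subfield K \<Longrightarrow> K \<subseteq> F \<Longrightarrow> is_subfield (\<sigma> ` K)"
proof -
  assume K: "is_subfield K" and sub: "K \<subseteq> F"
  have "\<forall>x\<in>\<sigma> ` K. inverse x \<in> \<sigma> ` K"
    using sub by (force simp: hom_on_inverse[symmetric] is_subfieldD(6)[OF K])
  then show ?thesis
    using hom_on_image_subring[OF is_subfield_subring[OF K] hom_on_subset[OF \<sigma> sub]]
    by (simp add: is_subfield_def subring_set_def)
qed

lemma hom_on_preimage_subfield: "is_subfield K \<Longrightarrow> is_subfield {x \<in> F. \<sigma> x \<in> K}"
  using \<sigma> hom_on_0[OF is_subfield_subring[OF F] \<sigma>] hom_on_minus[OF is_subfield_subring[OF F] \<sigma>]
    hom_on_inverse F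
  by (auto simp: is_subfield_def hom_on_def)

text \<open>One inclusion holds because the image of a subfield is a subfield, the other because a
  preimage is.\<close>

lemma hom_on_image_hull:
  assumes S: "S \<subseteq> F"
  shows "\<sigma> ` (is_subfield hull S) = is_subfield hull (\<sigma> ` S)"
proof
  have sub: "is_subfield hull S \<subseteq> F"
    by (rule hull_minimal) (use S F in auto)
  show "is_subfield hull (\<sigma> ` S) \<subseteq> \<sigma> ` (is_subfield hull S)"
    by (rule hull_minimal) (simp_all add: hull_subset image_mono hom_on_image_subfield[OF is_subfield_hull sub])
  have "is_subfield hull S \<subseteq> {x \<in> F. \<sigma> x \<in> is_subfield hull (\<sigma> ` S)}"
    by (rule hull_minimal) (use S in \<open>auto intro: hull_inc hom_on_preimage_subfield[OF is_subfield_hull]\<close>)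
  then show "\<sigma> ` (is_subfield hull S) \<subseteq> is_subfield hull (\<sigma> ` S)" by auto
qed

end

lemma hom_on_eq_hull:
  fixes \<sigma> \<tau> :: "'a::field \<Rightarrow> 'b::field"
  assumes F: "is_subfield F" and \<sigma>: "hom_on F \<sigma>" and \<tau>: "hom_on F \<tau>"
    and S: "S \<subseteq> F" "\<And>x. x \<in> S \<Longrightarrow> \<sigma> x = \<tau> x" and x: "x \<in> is_subfield hull S"
  shows "\<sigma> x = \<tau> x"
proof -
  note hom = hom_on_0[OF is_subfield_subring[OF F]] hom_on_minus[OF is_subfield_subring[OF F]]
    hom_on_inverse[OF F]
  have "is_subfield hull S \<subseteq> {x \<in> F. \<sigma> x = \<tau> x}"
  proof (rule hull_minimal)
    show "is_subfield {x \<in> F. \<sigma> x = \<tau> x}"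
      using \<sigma> \<tau> hom[OF \<sigma>] hom[OF \<tau>] F by (auto simp: is_subfield_def hom_on_def)
  qed (use S in auto)
  then show ?thesis using x by auto
qed

lemma hull_hull_Un: "is_subfield hull (is_subfield hull S \<union> T) = is_subfield hull (S \<union> T)"
  by (metis hull_Un_left)

section \<open>Algebraic independence of families\<close>

text \<open>The family version of \<open>algebraically_independent\<close>, which is the case
  \<open>f = id\<close>. With a free index type the same indeterminates can be evaluated at
  different families, and reindexing is a substitution.\<close>

definition indep :: "'b::field set \<Rightarrow> 'v set \<Rightarrow> ('v \<Rightarrow> 'b) \<Rightarrow> bool" where
  "indep L X f \<longleftrightarrow> (\<forall>p\<in>polys_over L X. poly_eval id f p = 0 \<longrightarrow> p = 0)"

lemma algebraically_independent_iff: "algebraically_independent k B \<longleftrightarrow> indep k B id"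
  unfolding algebraically_independent_def indep_def polys_over_def by blast

lemma indepD: "indep L X f \<Longrightarrow> p \<in> polys_over L X \<Longrightarrow> poly_eval id f p = 0 \<Longrightarrow> p = 0"
  by (simp add: indep_def)

lemma indep_mono: "indep L X f \<Longrightarrow> K \<subseteq> L \<Longrightarrow> Y \<subseteq> X \<Longrightarrow> indep K Y f"
  using polys_over_mono[of K L Y X] by (auto simp: indep_def)

lemma indep_cong: "(\<And>v. v \<in> X \<Longrightarrow> f v = g v) \<Longrightarrow> indep L X f \<longleftrightarrow> indep L X g"
  unfolding indep_def by (intro ball_cong refl arg_cong[where f="\<lambda>x. x = 0 \<longrightarrow> _"] poly_eval_cong) auto

lemma poly_eval_0 [simp]: "poly_eval a x 0 = 0"
  by (simp add: poly_eval_def)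

text \<open>A relation \<open>p\<close> for \<open>g\<close> becomes the relation
  \<open>p(q)\<close> for \<open>f\<close>, so \<open>p(q) = 0\<close> as a polynomial. Substituting
  \<open>r\<close>, which undoes the substitution \<open>q\<close>, recovers
  \<open>p\<close>.\<close>

lemma indep_subst:
  assumes L: "is_subfield L" and f: "indep L X f"
    and q: "\<And>w. w \<in> Y \<Longrightarrow> q w \<in> polys_over L X"
    and rq: "\<And>w. w \<in> Y \<Longrightarrow> poly_eval PConst r (q w) = PVar w"
    and g: "\<And>w. w \<in> Y \<Longrightarrow> g w = poly_eval id f (q w)"
  shows "indep L Y g"
  unfolding indep_def
proof (intro ballI impI)
  fix p assume p: "p \<in> polys_over L Y" "poly_eval id g p = 0"
  note L = is_subfield_subring[OF L]
  note LX = subring_set_polys_over[OF L, of X]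
  define s where "s = poly_eval PConst q p"
  have s: "s \<in> polys_over L X"
    unfolding s_def by (rule poly_eval_in[OF p(1) LX]) (auto intro: q PConst_in subring_setD[OF L])
  have "poly_eval id f s = poly_eval (poly_eval id f \<circ> PConst) (poly_eval id f \<circ> q) p"
    unfolding s_def
    by (rule hom_on_poly_eval_comp[OF LX hom_on_poly_eval[OF L] p(1)])
      (auto intro: q PConst_in subring_setD[OF L])
  also have "\<dots> = poly_eval id g p"
    by (rule poly_eval_cong[OF p(1)]) (auto simp: poly_eval_PConst g)
  finally have "s = 0" using indepD[OF f s] p(2) by simp
  have "0 = poly_eval PConst r s" by (simp add: \<open>s = 0\<close>)
  also have "\<dots> = poly_eval (poly_eval PConst r \<circ> PConst) (poly_eval PConst r \<circ> q) p"
    unfolding s_def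
    by (rule hom_on_poly_eval_comp[OF LX hom_on_poly_eval[OF L hom_on_PConst] p(1)])
      (auto intro: q PConst_in subring_setD[OF L])
  also have "\<dots> = poly_eval PConst PVar p"
    by (rule poly_eval_cong[OF p(1)]) (auto simp: poly_eval_PConst rq)
  finally show "p = 0" by (simp add: poly_eval_PConst_PVar)
qed

text \<open>A relation over the image of \<open>L\<close> is pulled back along
  \<open>inv_into L \<sigma>\<close>. Since \<open>\<sigma>\<close> is injective on
  \<open>F\<close>, the result is a relation for \<open>f\<close>, hence zero, and pushing its
  coefficients forward returns the original polynomial.\<close>

lemma indep_hom_on:
  assumes F: "is_subfield F" and \<sigma>: "hom_on F \<sigma>" and L: "is_subfield L" "L \<subseteq> F"
    and f: "indep L X f" "\<And>v. v \<in> X \<Longrightarrow> f v \<in> F"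
  shows "indep (\<sigma> ` L) X (\<lambda>v. \<sigma> (f v))"
  unfolding indep_def
proof (intro ballI impI)
  fix p assume p: "p \<in> polys_over (\<sigma> ` L) X" "poly_eval id (\<lambda>v. \<sigma> (f v)) p = 0"
  note LX = subring_set_polys_over[OF is_subfield_subring[OF L(1)], of X]
  define q where "q = poly_eval (PConst \<circ> inv_into L \<sigma>) PVar p"
  have inv: "inv_into L \<sigma> c \<in> L" "\<sigma> (inv_into L \<sigma> c) = c" if "c \<in> \<sigma> ` L" for c
    using that by (simp_all add: inv_into_into f_inv_into_f)
  have q: "q \<in> polys_over L X"
    unfolding q_def by (rule poly_eval_in[OF p(1) LX])
      (auto intro!: PConst_in PVar_in inv is_subfieldD[OF L(1)])
  have "poly_eval id f q = poly_eval (poly_eval id f \<circ> (PConst \<circ> inv_into L \<sigma>)) (poly_eval id f \<circ> PVar) p"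
    unfolding q_def by (rule hom_on_poly_eval_comp[OF LX hom_on_poly_eval[OF is_subfield_subring[OF L(1)]] p(1)])
      (auto intro!: PConst_in PVar_in inv is_subfieldD[OF L(1)])
  also have "\<dots> = poly_eval (inv_into L \<sigma>) f p"
    by (rule poly_eval_cong[OF p(1)]) (auto simp: poly_eval_PConst poly_eval_PVar)
  finally have "\<sigma> (poly_eval id f q) = \<sigma> (poly_eval (inv_into L \<sigma>) f p)" by simp
  also have "\<dots> = poly_eval (\<sigma> \<circ> inv_into L \<sigma>) (\<sigma> \<circ> f) p"
    by (rule hom_on_poly_eval_comp[OF is_subfield_subring[OF F] \<sigma> p(1)])
      (use L(2) inv f in auto)
  also have "\<dots> = poly_eval id (\<lambda>v. \<sigma> (f v)) p"
    by (rule poly_eval_cong[OF p(1)]) (auto simp: inv)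
  finally have "\<sigma> (poly_eval id f q) = 0" by (simp add: p(2))
  moreover have "poly_eval id f q \<in> F"
    by (rule poly_eval_in[OF q is_subfield_subring[OF F]]) (use L(2) f in auto)
  ultimately have "q = 0"
    using hom_on_eq_0[OF F \<sigma>] indepD[OF f(1) q] by blast
  have hom: "hom_on L (PConst \<circ> \<sigma>)"
    by (rule hom_on_comp[OF hom_on_subset[OF \<sigma> L(2)] hom_on_PConst[of UNIV]]) simp
  have "0 = poly_eval (PConst \<circ> \<sigma>) PVar q" by (simp add: \<open>q = 0\<close>)
  also have "\<dots> = poly_eval (poly_eval (PConst \<circ> \<sigma>) PVar \<circ> (PConst \<circ> inv_into L \<sigma>))
      (poly_eval (PConst \<circ> \<sigma>) PVar \<circ> PVar) p"
    unfolding q_def by (rule hom_on_poly_eval_comp[OF LX hom_on_poly_eval[OF is_subfield_subring[OF L(1)] hom] p(1)])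
      (auto intro!: PConst_in PVar_in inv is_subfieldD[OF L(1)])
  also have "\<dots> = poly_eval PConst PVar p"
    using hom_on_0[OF is_subfield_subring[OF F] \<sigma>] \<sigma>
    by (intro poly_eval_cong[OF p(1)])
      (auto simp: poly_eval_PConst poly_eval_PVar inv hom_on_def PConst_1)
  finally show "p = 0" by (simp add: poly_eval_PConst_PVar)
qed

lemma indep_reindex:
  assumes L: "is_subfield L" and e: "inj_on e X" and f: "indep L (e ` X) f"
  shows "indep L X (\<lambda>v. f (e v))"
  by (rule indep_subst[OF L f, where q = "\<lambda>w. PVar (e w)" and r = "\<lambda>v. PVar (inv_into X e v)"])
    (auto simp: poly_eval_PVar PVar_in is_subfieldD[OF L] e PConst_1)

lemma PVar_eq_iff: "PVar v = (PVar w :: ('v, 'a::comm_ring_1) mpoly) \<longleftrightarrow> v = w"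
proof
  assume *: "PVar v = (PVar w :: ('v, 'a) mpoly)"
  have "Poly_Mapping.lookup (PVar v :: ('v, 'a) mpoly) (Poly_Mapping.single v 1) = 1" by (simp add: PVar_def)
  then have "Poly_Mapping.single w 1 = Poly_Mapping.single v (1::nat)"
    unfolding * by (simp add: PVar_def lookup_single when_def split: if_splits)
  then show "v = w"
    by (metis lookup_single_eq lookup_single_not_eq zero_neq_one)
qed simp

lemma indep_inj_on:
  fixes f :: "'v \<Rightarrow> 'b::field"
  assumes L: "is_subfield L" and f: "indep L X f"
  shows "inj_on f X"
proof (rule inj_onI)
  fix v w assume vw: "v \<in> X" "w \<in> X" "f v = f w"
  note LX = subring_set_polys_over[OF is_subfield_subring[OF L], of X]
  have p: "PVar v \<in> polys_over L X" "PVar w \<in> polys_over L X"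
    using vw by (auto simp: PVar_in is_subfieldD[OF L])
  then have "poly_eval id f (PVar v - PVar w) = 0"
    using poly_eval_add_on[OF is_subfield_subring[OF L] hom_on_id(1), of "PVar v - PVar w" X "PVar w" f]
    by (simp add: poly_eval_PVar subring_setD[OF LX] vw)
  then have "PVar v - PVar w = (0 :: ('v, 'b) mpoly)" by (rule indepD[OF f, rotated]) (intro subring_setD[OF LX] p)
  then show "v = w" by (simp add: PVar_eq_iff)
qed

text \<open>Passes from families to sets, in terms of which \<open>purely_transcendental\<close> is
  stated. Independence makes the family injective, so its inverse serves as a reindexing.\<close>

lemma indep_image:
  assumes L: "is_subfield L" and f: "indep L X f"
  shows "indep L (f ` X) id"
proof -
  have "indep L (f ` X) (\<lambda>v. f (inv_into X f v))"
    by (rule indep_reindex[OF L inj_on_inv_into]) (simp_all add: indep_inj_on[OF L f] f)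
  then show ?thesis
    by (rule indep_cong[THEN iffD1, rotated]) (simp add: f_inv_into_f)
qed

text \<open>The quotients of polynomial values form a subfield containing all generators. The
  denominator is required to have a nonzero value, since without independence a nonzero polynomial
  may vanish at \<open>f\<close>.\<close>

lemma hull_fraction:
  assumes L: "is_subfield L" and u: "u \<in> is_subfield hull (L \<union> f ` X)"
  shows "\<exists>p\<in>polys_over L X. \<exists>q\<in>polys_over L X. poly_eval id f q \<noteq> 0 \<and> u = poly_eval id f p / poly_eval id f q"
proof -
  let ?ev = "poly_eval id f" and ?P = "polys_over L X"
  note P = subring_set_polys_over[OF is_subfield_subring[OF L], of X]
  note ev = poly_eval_add_on[OF is_subfield_subring[OF L] hom_on_id(1), of _ X _ f]
    poly_eval_mult_on[OF is_subfield_subring[OF L] hom_on_id(1), of _ X _ f]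
    hom_on_minus[OF P hom_on_poly_eval[OF is_subfield_subring[OF L] hom_on_id(1)]]
  define Q where "Q = {u. \<exists>p\<in>?P. \<exists>q\<in>?P. ?ev q \<noteq> 0 \<and> u = ?ev p / ?ev q}"
  have Const: "PConst c \<in> ?P" "?ev (PConst c) = c" if "c \<in> L" for c
    using that by (auto simp: PConst_in is_subfieldD[OF L] poly_eval_PConst)
  have one: "PConst 1 \<in> ?P" "?ev (PConst 1) = 1" by (intro Const is_subfieldD[OF L])+
  have Var: "PVar v \<in> ?P" "?ev (PVar v) = f v" if "v \<in> X" for v
    using that by (auto simp: PVar_in is_subfieldD[OF L] poly_eval_PVar)
  have I: "?ev p \<in> Q" if "p \<in> ?P" for p
    unfolding Q_def using that one by force
  have "is_subfield Q"
    unfolding is_subfield_def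
  proof (intro conjI ballI)
    show "0 \<in> Q" "1 \<in> Q"
      using I[OF one(1)] I[of 0] P by (simp_all add: one subring_setD)
  next
    fix x y assume "x \<in> Q" "y \<in> Q"
    then obtain p q r s where *: "p \<in> ?P" "q \<in> ?P" "r \<in> ?P" "s \<in> ?P" "?ev q \<noteq> 0" "?ev s \<noteq> 0"
      "x = ?ev p / ?ev q" "y = ?ev r / ?ev s" unfolding Q_def by blast
    have "x + y = ?ev (p * s + r * q) / ?ev (q * s)" "x * y = ?ev (p * r) / ?ev (q * s)" "?ev (q * s) \<noteq> 0"
      unfolding *(7,8) using *(1-6) by (simp_all add: ev subring_setD[OF P] add_frac_eq)
    then show "x + y \<in> Q" "x * y \<in> Q"
      unfolding Q_def using *(1-4) by (blast intro: subring_setD[OF P])+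
  next
    fix x assume "x \<in> Q"
    then obtain p q where *: "p \<in> ?P" "q \<in> ?P" "?ev q \<noteq> 0" "x = ?ev p / ?ev q" unfolding Q_def by blast
    have "- x = ?ev (- p) / ?ev q" using * by (simp add: ev)
    then show "- x \<in> Q"
      unfolding Q_def using *(1-3) by (blast intro: subring_setD[OF P])
    show "inverse x \<in> Q"
    proof (cases "?ev p = 0")
      \<comment> \<open>Here \<open>x = 0\<close>, and \<open>inverse 0 = 0\<close> is again such a
        quotient.\<close>
      case True
      then show ?thesis using * I[of 0] subring_setD(1)[OF P] by simp
    next
      case False
      have "inverse x = ?ev q / ?ev p" using * by simp
      with False show ?thesis
        unfolding Q_def using *(1-3) by blast
    qed
  qed
  then have "is_subfield hull (L \<union> f ` X) \<subseteq> Q"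
    by (rule hull_minimal[rotated]) (use I Const Var in \<open>fastforce\<close>)
  with u show ?thesis unfolding Q_def by blast
qed

lemma poly_eval_in_hull: "p \<in> polys_over L X \<Longrightarrow> poly_eval id f p \<in> is_subfield hull (L \<union> f ` X)"
  by (erule poly_eval_in[OF _ is_subfield_hull_subring]) (auto intro: hull_inc)

text \<open>Used to clear the denominators of all coefficients of a polynomial over the generated
  field at once.\<close>

lemma hull_common_denominator:
  assumes L: "is_subfield L" and Z: "finite Z" "Z \<subseteq> is_subfield hull (L \<union> f ` X)"
  shows "\<exists>d\<in>polys_over L X. poly_eval id f d \<noteq> 0 \<and>
    (\<forall>z\<in>Z. \<exists>n\<in>polys_over L X. z * poly_eval id f d = poly_eval id f n)"
  using Z
proof (induction Z rule: finite_induct)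
  case empty
  have "PConst 1 \<in> polys_over L X" "poly_eval id f (PConst 1) = 1"
    by (auto simp: PConst_in is_subfieldD[OF L] poly_eval_PConst)
  then show ?case by (metis empty_iff zero_neq_one)
next
  case (insert u Z)
  let ?ev = "poly_eval id f" and ?P = "polys_over L X"
  note P = subring_set_polys_over[OF is_subfield_subring[OF L], of X]
  note mult = poly_eval_mult_on[OF is_subfield_subring[OF L] hom_on_id(1), of _ X _ f]
  from insert obtain d where d: "d \<in> ?P" "?ev d \<noteq> 0" "\<forall>z\<in>Z. \<exists>n\<in>?P. z * ?ev d = ?ev n"
    by blast
  from insert hull_fraction[OF L, of u f X] obtain p q where
    pq: "p \<in> ?P" "q \<in> ?P" "?ev q \<noteq> 0" "u = ?ev p / ?ev q"
    by blast
  have "\<exists>n\<in>?P. z * ?ev (d * q) = ?ev n" if "z \<in> insert u Z" for z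
  proof (cases "z = u")
    case True
    then have "z * ?ev (d * q) = ?ev (d * p)" using d pq by (simp add: mult)
    then show ?thesis using d pq by (blast intro: subring_setD[OF P])
  next
    case False
    then obtain n where "n \<in> ?P" "z * ?ev d = ?ev n" using d(3) \<open>z \<in> insert u Z\<close> by auto
    moreover from this have "z * ?ev (d * q) = ?ev (n * q)" using d pq by (simp add: mult flip: mult.assoc)
    ultimately show ?thesis using pq by (blast intro: subring_setD[OF P])
  qed
  moreover have "d * q \<in> ?P" "?ev (d * q) \<noteq> 0" using d pq by (auto simp: mult subring_setD[OF P])
  ultimately show ?case by blast
qed

text \<open>The evaluation \<open>poly_eval (PConst \<circ> g) PVar\<close> is how "apply
  \<open>g\<close> to every coefficient" is expressed throughout. Only \<open>g 0 = 0\<close> is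
  asked, so \<open>g\<close> may also be multiplication by a fixed scalar.\<close>

lemma lookup_map_coeffs:
  fixes P :: "('v, 'a::comm_ring_1) mpoly" and g :: "'a \<Rightarrow> 'b::comm_ring_1"
  assumes "g 0 = 0"
  shows "Poly_Mapping.lookup (poly_eval (PConst \<circ> g) PVar P) m = g (Poly_Mapping.lookup P m)"
proof -
  have "poly_eval (PConst \<circ> g) PVar P = (\<Sum>m\<in>Poly_Mapping.keys P. Poly_Mapping.single m (g (Poly_Mapping.lookup P m)))"
    by (simp add: poly_eval_mon mon_eval_PVar PConst_def mult_single)
  then show ?thesis
    using assms by (auto simp: lookup_sum lookup_single when_def in_keys_iff)
qed

text \<open>
  Reads a polynomial as a polynomial in the indeterminates outside \<open>X\<close> with coefficients in the
  polynomials in \<open>X\<close>; the inverse operation is \<^term>\<open>poly_eval id PVar\<close>.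
\<close>

definition separate :: "'v set \<Rightarrow> ('v, 'a::comm_ring_1) mpoly \<Rightarrow> ('v, ('v, 'a) mpoly) mpoly" where
  "separate X = poly_eval (PConst \<circ> PConst) (\<lambda>v. if v \<in> X then PConst (PVar v) else PVar v)"

lemma hom_on_PConst_comp: "hom_on R a \<Longrightarrow> hom_on R (PConst \<circ> a)"
  by (rule hom_on_comp[OF _ hom_on_PConst[of UNIV]]) simp_all

lemma hom_on_separate: "hom_on UNIV (separate X)"
  unfolding separate_def
  using hom_on_poly_eval[OF subring_set_UNIV hom_on_PConst_comp[OF hom_on_PConst], of UNIV]
  by simp

lemma hom_on_collapse: "hom_on UNIV (poly_eval id PVar :: ('v, ('v, 'a::comm_ring_1) mpoly) mpoly \<Rightarrow> _)"
  using hom_on_poly_eval[OF subring_set_UNIV hom_on_id(1), of UNIV] by simp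

lemma separate_in:
  assumes R: "subring_set R" and p: "p \<in> polys_over R (X \<union> Y)"
  shows "separate X p \<in> polys_over (polys_over R X) Y"
proof -
  note P = subring_set_polys_over[OF R, of X]
  note PP = subring_set_polys_over[OF P, of Y]
  show ?thesis
    unfolding separate_def
    by (rule poly_eval_in[OF p PP])
      (auto intro!: PConst_in PVar_in subring_setD[OF P] subring_setD[OF R])
qed

lemma collapse_separate: "poly_eval id PVar (separate X p) = p"
proof -
  have "poly_eval id PVar (separate X p) =
      poly_eval (poly_eval id PVar \<circ> (PConst \<circ> PConst))
        (poly_eval id PVar \<circ> (\<lambda>v. if v \<in> X then PConst (PVar v) else PVar v)) p"
    unfolding separate_def
    by (rule hom_on_poly_eval_comp[OF subring_set_UNIV hom_on_collapse, of p UNIV UNIV]) auto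
  also have "\<dots> = poly_eval PConst PVar p"
    by (rule poly_eval_cong[of p UNIV UNIV]) (auto simp: poly_eval_PConst poly_eval_PVar PConst_1)
  finally show ?thesis by (simp add: poly_eval_PConst_PVar)
qed

lemma collapse_in:
  assumes R: "subring_set R" and P: "P \<in> polys_over (polys_over R X) Y"
  shows "poly_eval id PVar P \<in> polys_over R (X \<union> Y)"
  by (rule poly_eval_in[OF P subring_set_polys_over[OF R]])
    (use polys_over_mono[of R R X "X \<union> Y"] in \<open>auto intro!: PVar_in subring_setD[OF R]\<close>)

text \<open>Disjointness matters: an outer indeterminate from \<open>Y\<close> that also lay in
  \<open>X\<close> would come back inside a coefficient.\<close>

lemma separate_collapse:
  assumes R: "subring_set R" and XY: "X \<inter> Y = {}" and P: "P \<in> polys_over (polys_over R X) Y"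
  shows "separate X (poly_eval id PVar P) = P"
proof -
  have PConst: "separate X c = PConst c" if "c \<in> polys_over R X" for c
  proof -
    have "separate X c = poly_eval (PConst \<circ> PConst) (PConst \<circ> PVar) c"
      unfolding separate_def by (rule poly_eval_cong[OF that]) auto
    also have "\<dots> = PConst (poly_eval PConst PVar c)"
      by (rule hom_on_poly_eval_comp[OF subring_set_UNIV hom_on_PConst, symmetric, of c UNIV UNIV]) auto
    finally show ?thesis by (simp add: poly_eval_PConst_PVar)
  qed
  have "separate X (poly_eval id PVar P) = poly_eval (separate X \<circ> id) (separate X \<circ> PVar) P"
    by (rule hom_on_poly_eval_comp[OF subring_set_UNIV hom_on_separate, of P UNIV UNIV]) auto
  also have "\<dots> = poly_eval PConst PVar P"
    by (rule poly_eval_cong[OF P])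
      (use XY in \<open>auto simp: PConst, auto simp: separate_def poly_eval_PVar PConst_1\<close>)
  finally show ?thesis by (simp add: poly_eval_PConst_PVar)
qed

lemma poly_eval_collapse:
  assumes R: "subring_set R" and P: "P \<in> polys_over (polys_over R X) Y"
  shows "poly_eval id f (poly_eval id PVar P) = poly_eval (poly_eval id f) f P"
proof -
  have "poly_eval id f (poly_eval id PVar P) = poly_eval (poly_eval id f \<circ> id) (poly_eval id f \<circ> PVar) P"
    by (rule hom_on_poly_eval_comp[OF subring_set_polys_over[OF R, of "X \<union> Y"] hom_on_poly_eval[OF R hom_on_id(1)] P])
      (use polys_over_mono[of R R X "X \<union> Y"] in \<open>auto intro!: PVar_in subring_setD[OF R]\<close>)
  also have "\<dots> = poly_eval (poly_eval id f) f P"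
    by (rule poly_eval_cong[OF P]) (auto simp: poly_eval_PVar)
  finally show ?thesis .
qed

text \<open>A relation in \<open>X \<union> Y\<close> is read as one in \<open>Y\<close> whose
  coefficients are polynomials in \<open>X\<close>. Independence of \<open>Y\<close> over the larger
  field kills the values of these coefficients, and independence of \<open>X\<close> over
  \<open>L\<close> then kills the coefficients themselves.\<close>

lemma indep_Un:
  assumes L: "is_subfield L" and X: "indep L X f" and Y: "indep (is_subfield hull (L \<union> f ` X)) Y f"
  shows "indep L (X \<union> Y) f"
  unfolding indep_def
proof (intro ballI impI)
  fix p assume p: "p \<in> polys_over L (X \<union> Y)" "poly_eval id f p = 0"
  let ?M = "is_subfield hull (L \<union> f ` X)"
  note R = is_subfield_subring[OF L]
  note PP = separate_in[OF R p(1)]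
  define P where "P = separate X p"
  define M where "M = poly_eval (PConst \<circ> poly_eval id f) PVar P"
  have lookup: "Poly_Mapping.lookup M m = poly_eval id f (Poly_Mapping.lookup P m)" for m
    unfolding M_def by (rule lookup_map_coeffs) simp
  have lookup_P: "Poly_Mapping.lookup P m \<in> polys_over L X" for m
    using PP by (auto simp: P_def polys_over_def)
  have M: "M \<in> polys_over ?M Y"
    unfolding M_def P_def
    by (rule poly_eval_in[OF PP subring_set_polys_over[OF is_subfield_hull_subring]])
      (auto intro!: PConst_in PVar_in poly_eval_in_hull is_subfieldD[OF is_subfield_hull])
  have "poly_eval id f M = poly_eval (poly_eval id f \<circ> (PConst \<circ> poly_eval id f)) (poly_eval id f \<circ> PVar) P"
    unfolding M_def P_def
    by (rule hom_on_poly_eval_comp[OF subring_set_polys_over[OF is_subfield_hull_subring]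
          hom_on_poly_eval[OF is_subfield_hull_subring hom_on_id(1)] PP, of _ "L \<union> f ` X" Y])
      (auto intro!: PConst_in PVar_in poly_eval_in_hull is_subfieldD[OF is_subfield_hull])
  also have "\<dots> = poly_eval (poly_eval id f) f P"
    by (rule poly_eval_cong[of P UNIV UNIV]) (auto simp: poly_eval_PConst poly_eval_PVar)
  also have "\<dots> = poly_eval id f p"
    using poly_eval_collapse[OF R PP, of f] by (simp add: P_def collapse_separate)
  finally have "M = 0" using p(2) indepD[OF Y M] by simp
  then have "poly_eval id f (Poly_Mapping.lookup P m) = 0" for m
    using lookup[of m] by simp
  then have "Poly_Mapping.lookup P m = 0" for m
    using indepD[OF X lookup_P] by blast
  then have "P = 0" by (intro poly_mapping_eqI) simp
  then show "p = 0" using collapse_separate[of X p] by (simp add: P_def)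
qed

text \<open>Multiplying a relation by a common denominator of its coefficients makes them values of
  polynomials in \<open>X\<close>. Flattening the result gives a relation in
  \<open>X \<union> Y\<close> over \<open>L\<close>, which must be zero.\<close>

lemma indep_over_hull:
  assumes L: "is_subfield L" and XY: "X \<inter> Y = {}" and f: "indep L (X \<union> Y) f"
  shows "indep (is_subfield hull (L \<union> f ` X)) Y f"
  unfolding indep_def
proof (intro ballI impI)
  let ?M = "is_subfield hull (L \<union> f ` X)" and ?ev = "poly_eval id f"
  fix p assume p: "p \<in> polys_over ?M Y" "?ev p = 0"
  note R = is_subfield_subring[OF L]
  have "finite (Poly_Mapping.lookup p ` Poly_Mapping.keys p)" "Poly_Mapping.lookup p ` Poly_Mapping.keys p \<subseteq> ?M"
    using p by (auto simp: polys_over_def)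
  from hull_common_denominator[OF L this] obtain d where d: "d \<in> polys_over L X" "?ev d \<noteq> 0"
    "\<forall>z\<in>Poly_Mapping.lookup p ` Poly_Mapping.keys p. \<exists>n\<in>polys_over L X. z * ?ev d = ?ev n"
    by blast
  then have "\<forall>m\<in>Poly_Mapping.keys p. \<exists>n. n \<in> polys_over L X \<and> Poly_Mapping.lookup p m * ?ev d = ?ev n"
    by blast
  from bchoice[OF this] obtain n where n: "\<And>m. m \<in> Poly_Mapping.keys p \<Longrightarrow> n m \<in> polys_over L X"
    "\<And>m. m \<in> Poly_Mapping.keys p \<Longrightarrow> Poly_Mapping.lookup p m * ?ev d = ?ev (n m)"
    by blast
  \<comment> \<open>\<open>P\<close> represents \<open>p\<close> multiplied by the common
    denominator, with each coefficient lifted to a chosen polynomial \<open>n m\<close> in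
    \<open>X\<close>.\<close>
  define P where "P = (\<Sum>m\<in>Poly_Mapping.keys p. Poly_Mapping.single m (n m))"
  note PX = subring_set_polys_over[OF R, of X]
  note PP = subring_set_polys_over[OF PX, of Y]
  have single: "Poly_Mapping.single m (n m) \<in> polys_over (polys_over L X) Y" if "m \<in> Poly_Mapping.keys p" for m
    by (rule polys_over_single[OF n(1)[OF that] subring_setD(1)[OF PX]]) (use that p in \<open>auto simp: polys_over_def\<close>)
  have P: "P \<in> polys_over (polys_over L X) Y"
    unfolding P_def by (rule subring_set_sum[OF PP single])
  have "?ev (poly_eval id PVar P) = poly_eval ?ev f P" by (rule poly_eval_collapse[OF R P])
  also have "\<dots> = (\<Sum>m\<in>Poly_Mapping.keys p. poly_eval ?ev f (Poly_Mapping.single m (n m)))"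
    unfolding P_def by (rule poly_eval_sum_on[OF PX hom_on_poly_eval[OF R hom_on_id(1)] single])
  also have "\<dots> = (\<Sum>m\<in>Poly_Mapping.keys p. ?ev d * (Poly_Mapping.lookup p m * mon_eval f m))"
  proof (intro sum.cong refl)
    fix m assume "m \<in> Poly_Mapping.keys p"
    have "poly_eval ?ev f (Poly_Mapping.single m (n m)) = ?ev (n m) * mon_eval f m"
      by (cases "n m = 0") (simp_all add: poly_eval_mon[of ?ev])
    then show "poly_eval ?ev f (Poly_Mapping.single m (n m)) = ?ev d * (Poly_Mapping.lookup p m * mon_eval f m)"
      using n(2)[OF \<open>m \<in> Poly_Mapping.keys p\<close>] by (metis mult.assoc mult.commute)
  qed
  also have "\<dots> = ?ev d * ?ev p" by (simp add: poly_eval_mon[of id f p] sum_distrib_left)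
  finally have "poly_eval id PVar P = 0"
    using p(2) by (intro indepD[OF f collapse_in[OF R P]]) simp
  then have "P = 0"
    using separate_collapse[OF R XY P] hom_on_0[OF subring_set_UNIV hom_on_separate, of X] by metis
  have "Poly_Mapping.lookup p m = 0" if m: "m \<in> Poly_Mapping.keys p" for m
  proof -
    have "Poly_Mapping.lookup P m = n m"
      using m by (simp add: P_def lookup_sum lookup_single when_def)
    then have "Poly_Mapping.lookup p m * ?ev d = 0"
      using n(2)[OF m] by (simp add: \<open>P = 0\<close>)
    then show ?thesis using d(2) by simp
  qed
  then have "Poly_Mapping.keys p = {}" by (meson equals0I in_keys_iff)
  then show "p = 0" by simp
qed

lemma indep_eq:
  assumes "is_subfield L" "indep L X f" "p \<in> polys_over L X" "q \<in> polys_over L X"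
    "poly_eval id f p = poly_eval id f q"
  shows "p = q"
proof -
  note P = subring_set_polys_over[OF is_subfield_subring[OF assms(1)], of X]
  have "poly_eval id f (p - q) = 0"
    using poly_eval_add_on[OF is_subfield_subring[OF assms(1)] hom_on_id(1), of "p - q" X q f] assms
    by (simp add: subring_setD[OF P])
  then have "p - q = 0"
    by (rule indepD[OF assms(2), rotated]) (simp add: subring_setD[OF P] assms)
  then show ?thesis by simp
qed

text \<open>The extension sends the quotient of the values of \<open>p\<close> and \<open>q\<close>
  at \<open>f\<close> to the quotient of their values at \<open>f'\<close>, with
  \<open>\<sigma>\<close> applied to the coefficients. Independence of \<open>f\<close> makes this
  well defined; independence of \<open>f'\<close> over the image of \<open>L\<close> keeps the
  denominators nonzero.\<close>

lemma hom_on_extend: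
  assumes L: "is_subfield L" and \<sigma>: "hom_on L \<sigma>" and f: "indep L X f" and f': "indep (\<sigma> ` L) X f'"
  obtains \<tau> where "hom_on (is_subfield hull (L \<union> f ` X)) \<tau>" "\<And>c. c \<in> L \<Longrightarrow> \<tau> c = \<sigma> c"
    "\<And>v. v \<in> X \<Longrightarrow> \<tau> (f v) = f' v"
proof
  let ?P = "polys_over L X" and ?ev = "poly_eval id f" and ?ev' = "poly_eval \<sigma> f'"
  note R = is_subfield_subring[OF L]
  note P = subring_set_polys_over[OF R, of X]
  note ev = poly_eval_add_on[OF R hom_on_id(1), of _ X _ f] poly_eval_mult_on[OF R hom_on_id(1), of _ X _ f]
  note ev' = poly_eval_add_on[OF R \<sigma>, of _ X _ f'] poly_eval_mult_on[OF R \<sigma>, of _ X _ f']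
  note \<sigma>R = hom_on_image_subring[OF R \<sigma>]
  have nz: "?ev' q \<noteq> 0" if q: "q \<in> ?P" "q \<noteq> 0" for q
  proof
    assume 0: "?ev' q = 0"
    define q' where "q' = poly_eval (PConst \<circ> \<sigma>) PVar q"
    have q': "q' \<in> polys_over (\<sigma> ` L) X"
      unfolding q'_def by (rule poly_eval_in[OF q(1) subring_set_polys_over[OF \<sigma>R]])
        (auto intro!: PConst_in PVar_in subring_setD[OF \<sigma>R])
    have "poly_eval id f' q' = poly_eval (poly_eval id f' \<circ> (PConst \<circ> \<sigma>)) (poly_eval id f' \<circ> PVar) q"
      unfolding q'_def
      by (rule hom_on_poly_eval_comp[OF subring_set_polys_over[OF \<sigma>R] hom_on_poly_eval[OF \<sigma>R hom_on_id(1)] q(1)])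
        (auto intro!: PConst_in PVar_in subring_setD[OF \<sigma>R])
    also have "\<dots> = ?ev' q"
      by (rule poly_eval_cong[OF q(1)]) (auto simp: poly_eval_PConst poly_eval_PVar)
    finally have "q' = 0" using indepD[OF f' q'] 0 by simp
    then have "\<sigma> (Poly_Mapping.lookup q m) = 0" for m
      using lookup_map_coeffs[of \<sigma> q m] hom_on_0[OF R \<sigma>] by (simp add: q'_def)
    then have "Poly_Mapping.lookup q m = 0" for m
      using hom_on_eq_0[OF L \<sigma>, of "Poly_Mapping.lookup q m"] q(1) by (simp add: polys_over_def)
    then have "q = 0" by (intro poly_mapping_eqI) simp
    with q(2) show False by simp
  qed
  \<comment> \<open>The choice ranges over all representations of \<open>u\<close>; the next step
    shows that they all give the same \<open>w\<close>.\<close>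
  define \<tau> where "\<tau> u = (SOME w. \<exists>p\<in>?P. \<exists>q\<in>?P. ?ev q \<noteq> 0 \<and> u = ?ev p / ?ev q \<and> w = ?ev' p / ?ev' q)" for u
  have \<tau>: "\<tau> (?ev p / ?ev q) = ?ev' p / ?ev' q" if pq: "p \<in> ?P" "q \<in> ?P" "?ev q \<noteq> 0" for p q
    unfolding \<tau>_def
  proof (rule some_equality)
    show "\<exists>p'\<in>?P. \<exists>q'\<in>?P. ?ev q' \<noteq> 0 \<and> ?ev p / ?ev q = ?ev p' / ?ev q' \<and> ?ev' p / ?ev' q = ?ev' p' / ?ev' q'"
      using pq by blast
    fix w assume "\<exists>p'\<in>?P. \<exists>q'\<in>?P. ?ev q' \<noteq> 0 \<and> ?ev p / ?ev q = ?ev p' / ?ev q' \<and> w = ?ev' p' / ?ev' q'"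
    then obtain p' q' where *: "p' \<in> ?P" "q' \<in> ?P" "?ev q' \<noteq> 0" "?ev p / ?ev q = ?ev p' / ?ev q'"
      "w = ?ev' p' / ?ev' q'" by blast
    then have "?ev (p * q') = ?ev (p' * q)" using pq by (simp add: ev frac_eq_eq)
    then have "p * q' = p' * q"
      using pq * by (intro indep_eq[OF L f]) (auto intro: subring_setD[OF P])
    then have "?ev' p * ?ev' q' = ?ev' p' * ?ev' q" using pq * by (metis ev'(2))
    moreover have "?ev' q \<noteq> 0" "?ev' q' \<noteq> 0"
      using pq(2,3) *(2,3) nz by force+
    ultimately show "w = ?ev' p / ?ev' q" using * by (simp add: frac_eq_eq)
  qed
  have one: "1 \<in> ?P" "?ev 1 = 1" "?ev' 1 = 1"
    using subring_setD[OF P] hom_on_poly_eval[OF R hom_on_id(1), of X f] hom_on_poly_eval[OF R \<sigma>, of X f']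
    by (auto simp: hom_on_def)
  have \<tau>ev: "\<tau> (?ev p) = ?ev' p" if "p \<in> ?P" for p
    using \<tau>[OF that one(1)] by (simp add: one)
  show "hom_on (is_subfield hull (L \<union> f ` X)) \<tau>"
    unfolding hom_on_def
  proof (intro conjI ballI)
    show "\<tau> 1 = 1" using \<tau>ev[OF one(1)] by (simp add: one)
    fix x y assume "x \<in> is_subfield hull (L \<union> f ` X)" "y \<in> is_subfield hull (L \<union> f ` X)"
    with hull_fraction[OF L] obtain p q r s where *: "p \<in> ?P" "q \<in> ?P" "r \<in> ?P" "s \<in> ?P"
      "?ev q \<noteq> 0" "?ev s \<noteq> 0" "x = ?ev p / ?ev q" "y = ?ev r / ?ev s" by metis
    have nz': "?ev' q \<noteq> 0" "?ev' s \<noteq> 0" using *(2,4-6) nz by force+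
    have "x + y = ?ev (p * s + r * q) / ?ev (q * s)" "x * y = ?ev (p * r) / ?ev (q * s)" "?ev (q * s) \<noteq> 0"
      unfolding *(7,8) using *(1-6) by (simp_all add: ev subring_setD[OF P] add_frac_eq)
    moreover have "p * s + r * q \<in> ?P" "q * s \<in> ?P" "p * r \<in> ?P" using * by (auto intro: subring_setD[OF P])
    ultimately have "\<tau> (x + y) = ?ev' (p * s + r * q) / ?ev' (q * s)" "\<tau> (x * y) = ?ev' (p * r) / ?ev' (q * s)"
      using \<tau>[of _ "q * s"] by metis+
    then show "\<tau> (x + y) = \<tau> x + \<tau> y" "\<tau> (x * y) = \<tau> x * \<tau> y"
      using *(1-6) nz' unfolding *(7,8) by (simp_all add: \<tau> ev' subring_setD[OF P] add_frac_eq)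
  qed
  show "\<tau> c = \<sigma> c" if "c \<in> L" for c
    using \<tau>ev[of "PConst c"] that hom_on_0[OF R \<sigma>]
    by (simp add: poly_eval_PConst PConst_in subring_setD[OF R])
  show "\<tau> (f v) = f' v" if "v \<in> X" for v
    using \<tau>ev[of "PVar v"] that \<sigma>
    by (simp add: poly_eval_PVar PVar_in subring_setD[OF R] hom_on_def)
qed

section \<open>Fixed fields\<close>

lemma fixed_field_subfield:
  assumes F: "is_subfield F" and hom: "\<And>g. g \<in> carrier G \<Longrightarrow> hom_on F (\<phi> g)"
  shows "is_subfield (fixed_field G F \<phi>)"
  using F hom hom_on_0[OF is_subfield_subring[OF F] hom] hom_on_minus[OF is_subfield_subring[OF F] hom]
    hom_on_inverse[OF F hom]
  by (auto simp: is_subfield_def fixed_field_def hom_on_def)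

text \<open>For a polynomial value the group acts only on the coefficients, since \<open>t\<close>
  is fixed, and independence makes the coefficients unique; so an invariant value has invariant
  coefficients. An invariant quotient is reduced to this case by making its denominator
  invariant.\<close>

lemma fixed_field_hull:
  fixes G (structure) and L :: "'b::field set" and t :: "'v \<Rightarrow> 'b" and \<phi> :: "_ \<Rightarrow> 'b \<Rightarrow> 'b"
  assumes "group G" and fin: "finite (carrier G)" and L: "is_subfield L" and t: "indep L X t"
    and hom: "\<And>g. g \<in> carrier G \<Longrightarrow> hom_on (is_subfield hull (L \<union> t ` X)) (\<phi> g)"
    and mult: "\<And>g h x. g \<in> carrier G \<Longrightarrow> h \<in> carrier G \<Longrightarrow> x \<in> is_subfield hull (L \<union> t ` X) \<Longrightarrow>
      \<phi> (g \<otimes> h) x = \<phi> g (\<phi> h x)"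
    and one: "\<And>x. x \<in> is_subfield hull (L \<union> t ` X) \<Longrightarrow> \<phi> \<one> x = x"
    and stable: "\<And>g c. g \<in> carrier G \<Longrightarrow> c \<in> L \<Longrightarrow> \<phi> g c \<in> L"
    and fixed: "\<And>g v. g \<in> carrier G \<Longrightarrow> v \<in> X \<Longrightarrow> \<phi> g (t v) = t v"
  shows "fixed_field G (is_subfield hull (L \<union> t ` X)) \<phi> = is_subfield hull (fixed_field G L \<phi> \<union> t ` X)"
proof
  interpret group G by fact
  let ?E = "is_subfield hull (L \<union> t ` X)" and ?L = "fixed_field G L \<phi>"
  have gens: "L \<subseteq> ?E" "t ` X \<subseteq> ?E" by (auto intro: hull_inc)
  note E = is_subfield_hull[of "L \<union> t ` X"]
  show "is_subfield hull (?L \<union> t ` X) \<subseteq> fixed_field G ?E \<phi>"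
    by (rule hull_minimal)
      (use gens fixed in \<open>auto simp: fixed_field_def
          intro!: fixed_field_subfield[OF E hom, unfolded fixed_field_def]\<close>)
  let ?P = "polys_over L X" and ?ev = "poly_eval id t"
  note R = is_subfield_subring[OF L]
  note P = subring_set_polys_over[OF R, of X]
  note hom_ev = hom_on_poly_eval[OF R hom_on_id(1), of X t]
  note Q = hom_on_image_subring[OF P hom_ev]
  have QE: "?ev ` ?P \<subseteq> ?E" by (auto intro: poly_eval_in_hull)
  \<comment> \<open>\<open>T g\<close> is the action of \<open>g\<close> on values at
    \<open>t\<close>, lifted to polynomials.\<close>
  define T where "T g p = poly_eval (PConst \<circ> \<phi> g) PVar p" for g and p :: "('v, 'b) mpoly"
  have T: "T g p \<in> ?P" "\<phi> g (?ev p) = ?ev (T g p)" if g: "g \<in> carrier G" and p: "p \<in> ?P" for g p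
  proof -
    show "T g p \<in> ?P"
      unfolding T_def by (rule poly_eval_in[OF p P]) (use g in \<open>auto intro!: PConst_in PVar_in stable subring_setD[OF R]\<close>)
    have "\<phi> g (?ev p) = poly_eval (\<phi> g \<circ> id) (\<phi> g \<circ> t) p"
      by (rule hom_on_poly_eval_comp[OF is_subfield_subring[OF E] hom[OF g] p]) (use gens in auto)
    also have "\<dots> = poly_eval (?ev \<circ> (PConst \<circ> \<phi> g)) (?ev \<circ> PVar) p"
      by (rule poly_eval_cong[OF p]) (use g in \<open>auto simp: poly_eval_PConst poly_eval_PVar fixed\<close>)
    also have "\<dots> = ?ev (T g p)"
      unfolding T_def
      by (rule hom_on_poly_eval_comp[OF P hom_ev p, symmetric])
        (use g in \<open>auto intro!: PConst_in PVar_in stable subring_setD[OF R]\<close>)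
    finally show "\<phi> g (?ev p) = ?ev (T g p)" .
  qed
  have poly: "r \<in> is_subfield hull (?L \<union> t ` X)"
    if r: "r \<in> ?ev ` ?P" and r_fixed: "\<And>g. g \<in> carrier G \<Longrightarrow> \<phi> g r = r" for r
  proof -
    from r obtain p where p: "p \<in> ?P" "r = ?ev p" by auto
    have "\<phi> g (Poly_Mapping.lookup p m) = Poly_Mapping.lookup p m" if g: "g \<in> carrier G" for g m
    proof -
      have "T g p = p"
        using r_fixed[OF g] T[OF g p(1)] p by (intro indep_eq[OF L t]) auto
      then show ?thesis
        using lookup_map_coeffs[of "\<phi> g" p m] hom_on_0[OF is_subfield_subring[OF E] hom[OF g]]
        by (simp add: T_def)
    qed
    then have "p \<in> polys_over ?L X" using p(1) by (auto simp: polys_over_def fixed_field_def)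
    then show ?thesis unfolding p(2) by (rule poly_eval_in_hull)
  qed
  show "fixed_field G ?E \<phi> \<subseteq> is_subfield hull (?L \<union> t ` X)"
  proof
    fix u assume "u \<in> fixed_field G ?E \<phi>"
    then have u: "u \<in> ?E" "\<And>g. g \<in> carrier G \<Longrightarrow> \<phi> g u = u" by (auto simp: fixed_field_def)
    from hull_fraction[OF L u(1)] obtain p q where pq: "p \<in> ?P" "q \<in> ?P" "?ev q \<noteq> 0" "u = ?ev p / ?ev q"
      by blast
    \<comment> \<open>\<open>d\<close> is the norm of the denominator: it is invariant, nonzero and
      still the value of a polynomial.\<close>
    define d where "d = (\<Prod>g\<in>carrier G. \<phi> g (?ev q))"
    have \<phi>q: "\<phi> g (?ev q) \<in> ?ev ` ?P" if "g \<in> carrier G" for g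
      using T[OF that pq(2)] by simp
    have \<phi>qE: "\<phi> g (?ev q) \<in> ?E" if "g \<in> carrier G" for g using QE \<phi>q[OF that] by blast
    have qE: "?ev q \<in> ?E" using QE pq(2) by blast
    have "d \<in> ?ev ` ?P" unfolding d_def by (rule subring_set_prod[OF Q \<phi>q])
    then have dE: "d \<in> ?E" using QE by blast
    have "d \<noteq> 0"
      unfolding d_def using fin hom_on_eq_0[OF E hom qE] pq(3) by simp
    have d_fixed: "\<phi> h d = d" if h: "h \<in> carrier G" for h
    proof -
      have "\<phi> h d = (\<Prod>g\<in>carrier G. \<phi> (h \<otimes> g) (?ev q))"
        unfolding d_def using hom_on_prod[OF is_subfield_subring[OF E] hom[OF h] \<phi>qE] 
        by (simp add: mult h qE)
      also have "\<dots> = d"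
        unfolding d_def
        by (rule prod.reindex_bij_witness[where i = "\<lambda>g. inv h \<otimes> g" and j = "\<lambda>g. h \<otimes> g"])
          (use h in \<open>auto simp flip: m_assoc\<close>)
      finally show ?thesis .
    qed
    \<comment> \<open>The factor of the unit is the old denominator itself, so it cancels in
      \<open>u * d\<close> and only polynomial values remain.\<close>
    have "d = ?ev q * (\<Prod>g\<in>carrier G - {\<one>}. \<phi> g (?ev q))"
      unfolding d_def using fin qE by (simp add: prod.remove[of _ \<one>] one)
    then have "u * d = ?ev p * (\<Prod>g\<in>carrier G - {\<one>}. \<phi> g (?ev q))"
      using pq by simp
    also have "\<dots> \<in> ?ev ` ?P"
      using pq(1) by (intro subring_setD(4)[OF Q] subring_set_prod[OF Q] \<phi>q) auto
    finally have "u * d \<in> ?ev ` ?P" .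
    moreover have "\<phi> g (u * d) = u * d" if "g \<in> carrier G" for g
      using hom[OF that] u dE d_fixed that by (simp add: hom_on_def)
    ultimately have "u * d \<in> is_subfield hull (?L \<union> t ` X)" by (rule poly)
    moreover have "d \<in> is_subfield hull (?L \<union> t ` X)" using \<open>d \<in> ?ev ` ?P\<close> d_fixed by (rule poly)
    ultimately have "u * d / d \<in> is_subfield hull (?L \<union> t ` X)"
      by (rule is_subfield_divide[OF is_subfield_hull])
    then show "u \<in> is_subfield hull (?L \<union> t ` X)" using \<open>d \<noteq> 0\<close> by simp
  qed
qed

section \<open>Rationality\<close>

lemma finitely_generated_extension_image:
  assumes "is_subfield F" "hom_on F \<sigma>" "finitely_generated_extension k F"
  shows "finitely_generated_extension (\<sigma> ` k) (\<sigma> ` F)"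
proof -
  from assms(3) obtain S where S: "finite S" "F = is_subfield hull (k \<union> S)"
    by (auto simp: finitely_generated_extension_def)
  then have "k \<union> S \<subseteq> F" by (simp add: hull_subset)
  from hom_on_image_hull[OF assms(1,2) this] have "\<sigma> ` F = is_subfield hull (\<sigma> ` k \<union> \<sigma> ` S)"
    by (simp add: S(2)[symmetric] image_Un)
  with S(1) show ?thesis unfolding finitely_generated_extension_def by blast
qed

text \<open>Moves rationality between fields over different indeterminates; the base field is moved
  along. A transcendence basis stays independent because a homomorphism on a field is
  injective.\<close>

lemma rational_image:
  assumes F: "is_subfield F" and \<sigma>: "hom_on F \<sigma>" and k: "is_subfield k" and "rational k F"
  shows "rational (\<sigma> ` k) (\<sigma> ` F)"
proof -
  from \<open>rational k F\<close> obtain B where B: "indep k B id" "F = is_subfield hull (k \<union> B)"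
    by (auto simp: rational_def purely_transcendental_def algebraically_independent_iff)
  then have sub: "k \<union> B \<subseteq> F" by (simp add: hull_subset)
  from hom_on_image_hull[OF F \<sigma> this] have "\<sigma> ` F = is_subfield hull (\<sigma> ` k \<union> \<sigma> ` B)"
    by (simp add: B(2)[symmetric] image_Un)
  moreover have "indep (\<sigma> ` k) (\<sigma> ` B) id"
    using indep_image[OF hom_on_image_subfield[OF F \<sigma> k] indep_hom_on[OF F \<sigma> k _ B(1)]] sub by auto
  ultimately show ?thesis
    using finitely_generated_extension_image[OF F \<sigma>] \<open>rational k F\<close>
    by (auto simp: rational_def purely_transcendental_def algebraically_independent_iff)
qed

text \<open>A transcendence basis of \<open>M\<close> and the elements \<open>t\<close> together
  form one of the larger field, by transitivity of independence.\<close>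

lemma rational_hull:
  assumes k: "is_subfield k" and "rational k M" and t: "indep M X t" and X: "finite X"
  shows "rational k (is_subfield hull (M \<union> t ` X))"
proof -
  from \<open>rational k M\<close> obtain B S where B: "indep k B id" "M = is_subfield hull (k \<union> B)"
    and S: "finite S" "M = is_subfield hull (k \<union> S)"
    by (auto simp: rational_def purely_transcendental_def algebraically_independent_iff
        finitely_generated_extension_def)
  have M: "is_subfield M" unfolding B(2) by (rule is_subfield_hull)
  have "indep k (B \<union> t ` X) id"
    using indep_Un[OF k B(1), of "t ` X"] indep_image[OF M t] by (simp add: B(2))
  moreover have "is_subfield hull (M \<union> t ` X) = is_subfield hull (k \<union> (B \<union> t ` X))"
    unfolding B(2) by (simp add: hull_hull_Un Un_assoc)
  moreover have "is_subfield hull (M \<union> t ` X) = is_subfield hull (k \<union> (S \<union> t ` X))"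
    unfolding S(2) by (simp add: hull_hull_Un Un_assoc)
  ultimately show ?thesis
    using S(1) X unfolding rational_def purely_transcendental_def algebraically_independent_iff
      finitely_generated_extension_def by blast
qed

text \<open>Finitely many generators of \<open>M(t)\<close> are quotients of polynomials in
  \<open>t\<close>, whose finitely many coefficients generate with \<open>k\<close> a subfield
  \<open>N\<close> of \<open>M\<close> such that \<open>N(t)\<close> contains \<open>M\<close>. If
  \<open>u\<close> in \<open>M\<close> equals \<open>p / q\<close> over \<open>N\<close>,
  independence gives \<open>u * q = p\<close> as polynomials, so \<open>u\<close> is a quotient of
  two coefficients.\<close>

lemma finitely_generated_extension_cancel:
  fixes M :: "'b::field set" and t :: "'v \<Rightarrow> 'b"
  assumes M: "is_subfield M" and k: "k \<subseteq> M" and t: "indep M X t"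
    and fg: "finitely_generated_extension k (is_subfield hull (M \<union> t ` X))"
  shows "finitely_generated_extension k M"
proof -
  let ?E = "is_subfield hull (M \<union> t ` X)" and ?ev = "poly_eval id t"
  from fg obtain S where S: "finite S" "?E = is_subfield hull (k \<union> S)"
    by (auto simp: finitely_generated_extension_def)
  have "\<forall>s\<in>S. \<exists>pq. fst pq \<in> polys_over M X \<and> snd pq \<in> polys_over M X \<and> s = ?ev (fst pq) / ?ev (snd pq)"
  proof
    fix s assume "s \<in> S"
    then have "s \<in> ?E" unfolding S(2) by (auto intro: hull_inc)
    from hull_fraction[OF M this] show "\<exists>pq. fst pq \<in> polys_over M X \<and> snd pq \<in> polys_over M X \<and> s = ?ev (fst pq) / ?ev (snd pq)"
      by auto
  qed
  from bchoice[OF this] obtain c where c: "\<And>s. s \<in> S \<Longrightarrow> fst (c s) \<in> polys_over M X"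
    "\<And>s. s \<in> S \<Longrightarrow> snd (c s) \<in> polys_over M X" "\<And>s. s \<in> S \<Longrightarrow> s = ?ev (fst (c s)) / ?ev (snd (c s))"
    by blast
  define coeffs where "coeffs p = Poly_Mapping.lookup p ` Poly_Mapping.keys p" for p :: "('v, 'b) mpoly"
  define C where "C = (\<Union>s\<in>S. coeffs (fst (c s)) \<union> coeffs (snd (c s)))"
  have "finite C" using S(1) by (auto simp: C_def coeffs_def)
  have "C \<subseteq> M" using c(1,2) by (auto simp: C_def coeffs_def polys_over_def)
  define N where "N = is_subfield hull (k \<union> C)"
  have N: "is_subfield N" unfolding N_def by (rule is_subfield_hull)
  have "N \<subseteq> M" unfolding N_def by (rule hull_minimal) (use \<open>C \<subseteq> M\<close> k M in auto)
  have N0: "0 \<in> N" using N by (simp add: is_subfieldD)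
  have coeffs_N: "p \<in> polys_over N X" if "p \<in> polys_over M X" "coeffs p \<subseteq> N" for p
  proof -
    have "Poly_Mapping.lookup p m \<in> N" for m
      using that(2) N0 by (cases "m \<in> Poly_Mapping.keys p") (auto simp: coeffs_def in_keys_iff)
    with that(1) show ?thesis by (auto simp: polys_over_def)
  qed
  have "C \<subseteq> N" unfolding N_def by (auto intro: hull_inc)
  have "s \<in> is_subfield hull (N \<union> t ` X)" if s: "s \<in> S" for s
  proof -
    have "fst (c s) \<in> polys_over N X" "snd (c s) \<in> polys_over N X"
      using s \<open>C \<subseteq> N\<close> c(1,2)[OF s] by (auto simp: C_def intro!: coeffs_N)
    then show ?thesis
      by (subst c(3)[OF s]) (intro is_subfield_divide[OF is_subfield_hull] poly_eval_in_hull)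
  qed
  moreover have "k \<subseteq> is_subfield hull (N \<union> t ` X)"
    by (auto simp: N_def intro!: hull_inc)
  ultimately have "?E \<subseteq> is_subfield hull (N \<union> t ` X)"
    unfolding S(2) by (intro hull_minimal) (auto simp: is_subfield_hull)
  moreover have "M \<subseteq> ?E" by (auto intro: hull_inc)
  ultimately have ME: "M \<subseteq> is_subfield hull (N \<union> t ` X)" by blast
  have "M \<subseteq> N"
  proof
    fix u assume u: "u \<in> M"
    with ME hull_fraction[OF N, of u t X] obtain p q where
      pq: "p \<in> polys_over N X" "q \<in> polys_over N X" "?ev q \<noteq> 0" "u = ?ev p / ?ev q" by blast
    then have pqM: "p \<in> polys_over M X" "q \<in> polys_over M X"
      using polys_over_mono[OF \<open>N \<subseteq> M\<close> subset_refl, of X] by auto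
    note P = subring_set_polys_over[OF is_subfield_subring[OF M], of X]
    \<comment> \<open>\<open>r\<close> is \<open>q\<close> with all coefficients multiplied by
      \<open>u\<close>; these lie in \<open>M\<close>, so \<open>r\<close> can be compared with
      \<open>p\<close> over \<open>M\<close>.\<close>
    define r where "r = poly_eval (PConst \<circ> (\<lambda>c. u * c)) PVar q"
    have r: "r \<in> polys_over M X"
      unfolding r_def by (rule poly_eval_in[OF pqM(2) P]) (auto intro!: PConst_in PVar_in is_subfieldD[OF M] u)
    have "?ev r = poly_eval (?ev \<circ> (PConst \<circ> (\<lambda>c. u * c))) (?ev \<circ> PVar) q"
      unfolding r_def
      by (rule hom_on_poly_eval_comp[OF P hom_on_poly_eval[OF is_subfield_subring[OF M] hom_on_id(1)] pqM(2)])
        (auto intro!: PConst_in PVar_in is_subfieldD[OF M] u)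
    also have "\<dots> = poly_eval (\<lambda>c. u * c) t q"
      by (rule poly_eval_cong[OF pqM(2)]) (auto simp: poly_eval_PConst poly_eval_PVar)
    also have "\<dots> = u * ?ev q" by (simp add: poly_eval_mon sum_distrib_left mult.assoc)
    also have "\<dots> = ?ev p" using pq by simp
    finally have "r = p" by (intro indep_eq[OF M t r pqM(1)])
    have "q \<noteq> 0" using pq(3) by auto
    then obtain m where m: "Poly_Mapping.lookup q m \<noteq> 0" by (metis poly_mapping_eqI lookup_zero)
    have "u * Poly_Mapping.lookup q m = Poly_Mapping.lookup p m"
      using lookup_map_coeffs[of "\<lambda>c. u * c" q m] \<open>r = p\<close> by (simp add: r_def)
    then have "u = Poly_Mapping.lookup p m / Poly_Mapping.lookup q m" using m by (simp add: field_simps)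
    also have "\<dots> \<in> N" using pq(1,2) by (intro is_subfield_divide[OF N]) (auto simp: polys_over_def)
    finally show "u \<in> N" .
  qed
  then show ?thesis
    using \<open>N \<subseteq> M\<close> \<open>finite C\<close> unfolding finitely_generated_extension_def N_def by blast
qed

section \<open>Vandermonde substitutions\<close>

lemma poly_altdef_lessThan:
  fixes p :: "'a::comm_semiring_1 poly"
  assumes "Polynomial.degree p < n"
  shows "poly p x = (\<Sum>i<n. Polynomial.coeff p i * x ^ i)"
  unfolding poly_altdef
  by (rule sum.mono_neutral_left) (use assms in \<open>auto simp: not_le coeff_eq_0\<close>)

lemma subring_set_coeff_mult:
  assumes R: "subring_set R" and "\<And>i. Polynomial.coeff p i \<in> R" "\<And>i. Polynomial.coeff q i \<in> R"
  shows "Polynomial.coeff (p * q) i \<in> R"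
  unfolding coeff_mult by (intro subring_set_sum[OF R] subring_setD(4)[OF R] assms)

text \<open>The inverse of a Vandermonde matrix consists of the coefficients of the Lagrange polynomials.\<close>

lemma vandermonde_inverse:
  fixes a :: "'s \<Rightarrow> 'b::field"
  assumes M: "is_subfield M" and S: "finite S" "inj_on a S" "a ` S \<subseteq> M"
  obtains B where "\<And>s i. s \<in> S \<Longrightarrow> B s i \<in> M"
    "\<And>s u. s \<in> S \<Longrightarrow> u \<in> S \<Longrightarrow> (\<Sum>i<card S. B s i * a u ^ i) = (if u = s then 1 else 0)"
    "\<And>i j. i < card S \<Longrightarrow> j < card S \<Longrightarrow> (\<Sum>s\<in>S. a s ^ i * B s j) = (if i = j then 1 else 0)"
proof
  note R = is_subfield_subring[OF M]
  define c where "c s = (\<Prod>u\<in>S - {s}. a s - a u)" for s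
  \<comment> \<open>The Lagrange numerator for \<open>s\<close> is \<open>P s (S - {s})\<close>; the
    set \<open>U\<close> is kept general so that membership of the coefficients in \<open>M\<close>
    can be shown by induction.\<close>
  define P where "P s U = (\<Prod>u\<in>U. [:- a u, 1:])" for s :: 's and U
  define l where "l s = Polynomial.smult (inverse (c s)) (P s (S - {s}))" for s
  define B where "B s i = Polynomial.coeff (l s) i" for s i
  have P_in: "Polynomial.coeff (P s U) i \<in> M" if "U \<subseteq> S" for s U i
    using finite_subset[OF that S(1)] that
  proof (induction U arbitrary: i rule: finite_induct)
    case empty
    then show ?case by (simp add: P_def is_subfieldD[OF M])
  next
    case (insert u U)
    have "Polynomial.coeff [:- a u, 1:] i \<in> M" for i
      using insert.prems S(3) by (auto simp: coeff_pCons is_subfieldD[OF M] split: nat.split)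
    then show ?case
      using insert unfolding P_def prod.insert[OF insert.hyps(1,2)] by (intro subring_set_coeff_mult[OF R]) auto
  qed
  show "B s i \<in> M" if "s \<in> S" for s i
  proof -
    have "c s \<in> M" unfolding c_def
      by (rule subring_set_prod[OF R]) (use that S(3) in \<open>auto intro!: subring_setD[OF R]\<close>)
    then show ?thesis
      unfolding B_def l_def coeff_smult by (intro is_subfieldD[OF M] P_in) auto
  qed
  have c: "c s \<noteq> 0" if "s \<in> S" for s
    using that S by (auto simp: c_def inj_on_def)
  have deg: "Polynomial.degree (l s) < card S" if "s \<in> S" for s
  proof -
    have "Polynomial.degree (P s (S - {s})) \<le> (\<Sum>u\<in>S - {s}. 1)"
      unfolding P_def by (rule order_trans[OF degree_prod_sum_le]) (use S(1) in auto)
    also have "\<dots> < card S" using card_Diff1_less[OF S(1) that] by simp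
    finally show ?thesis by (simp add: l_def le_less_trans[OF degree_smult_le])
  qed
  have l: "poly (l s) (a u) = (if u = s then 1 else 0)" if "s \<in> S" "u \<in> S" for s u
    using that S(1) c[OF that(1)] by (auto simp: l_def P_def poly_prod c_def add.commute)
  then show "(\<Sum>i<card S. B s i * a u ^ i) = (if u = s then 1 else 0)" if "s \<in> S" "u \<in> S" for s u
    using poly_altdef_lessThan[OF deg[OF that(1)], of "a u"] that by (simp add: B_def)
  show "(\<Sum>s\<in>S. a s ^ i * B s j) = (if i = j then 1 else 0)" if ij: "i < card S" "j < card S" for i j
  proof -
    \<comment> \<open>\<open>D\<close> is the interpolation of \<open>x ^ i\<close> at the nodes,
      minus \<open>x ^ i\<close> itself. Its degree is below \<open>card S\<close> and it vanishes
      at \<open>card S\<close> distinct nodes, so it is zero; the claim is its coefficient at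
      \<open>j\<close>.\<close>
    define D where "D = (\<Sum>s\<in>S. Polynomial.smult (a s ^ i) (l s)) - Polynomial.monom 1 i"
    have "Polynomial.degree (\<Sum>s\<in>S. Polynomial.smult (a s ^ i) (l s)) < card S"
      by (rule degree_sum_less) (use ij deg in \<open>auto intro: le_less_trans[OF degree_smult_le]\<close>)
    then have degD: "Polynomial.degree D < card S"
      unfolding D_def using ij by (intro degree_diff_less) (auto simp: degree_monom_eq)
    have "poly D (a u) = 0" if "u \<in> S" for u
      using that S(1) by (simp add: D_def poly_sum l poly_monom if_distrib[of "(*) _"] cong: if_cong)
    then have "a ` S \<subseteq> {x. poly D x = 0}" by auto
    then have "D = 0"
      using card_mono[of "{x. poly D x = 0}" "a ` S"] poly_roots_finite[of D] card_poly_roots_bound[of D]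
        card_image[OF S(2)] degD by (cases "D = 0") auto
    then have "Polynomial.coeff (\<Sum>s\<in>S. Polynomial.smult (a s ^ i) (l s)) j = Polynomial.coeff (Polynomial.monom 1 i) j" by (simp add: D_def)
    then show ?thesis by (simp add: coeff_sum B_def)
  qed
qed

text \<open>\<open>R\<close> indexes separate copies of one Vandermonde system, which is invertible
  over \<open>M\<close>. Hence either family is a combination of the other with coefficients in
  \<open>M\<close>, which gives equal generated fields, and \<open>B\<close> provides the inverse
  substitution for \<open>indep_subst\<close>.\<close>

lemma indep_vandermonde:
  fixes a :: "'s \<Rightarrow> 'b::field" and f :: "'r \<times> 's \<Rightarrow> 'b"
  assumes M: "is_subfield M" and S: "finite S" "inj_on a S" "a ` S \<subseteq> M"
  assumes z: "\<And>r i. r \<in> R \<Longrightarrow> z (r, i) = (\<Sum>s\<in>S. a s ^ i * f (r, s))"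
  shows "is_subfield hull (M \<union> z ` (R \<times> {..<card S})) = is_subfield hull (M \<union> f ` (R \<times> S))"
    and "indep M (R \<times> S) f \<Longrightarrow> indep M (R \<times> {..<card S}) z"
proof -
  from vandermonde_inverse[OF M S] obtain B where B: "\<And>s i. s \<in> S \<Longrightarrow> B s i \<in> M"
    "\<And>s u. s \<in> S \<Longrightarrow> u \<in> S \<Longrightarrow> (\<Sum>i<card S. B s i * a u ^ i) = (if u = s then 1 else 0)"
    "\<And>i j. i < card S \<Longrightarrow> j < card S \<Longrightarrow> (\<Sum>s\<in>S. a s ^ i * B s j) = (if i = j then 1 else 0)"
    by blast
  note MR = is_subfield_subring[OF M]
  let ?Z = "R \<times> {..<card S}" and ?F = "R \<times> S"
  have f: "f (r, s) = (\<Sum>i<card S. B s i * z (r, i))" if "r \<in> R" "s \<in> S" for r s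
  proof -
    have "(\<Sum>i<card S. B s i * z (r, i)) = (\<Sum>i<card S. \<Sum>u\<in>S. B s i * a u ^ i * f (r, u))"
      using that by (simp add: z sum_distrib_left mult.assoc)
    also have "\<dots> = (\<Sum>u\<in>S. \<Sum>i<card S. B s i * a u ^ i * f (r, u))" by (rule sum.swap)
    also have "\<dots> = (\<Sum>u\<in>S. (if u = s then 1 else 0) * f (r, u))"
      using that by (simp add: B(2) flip: sum_distrib_right)
    also have "\<dots> = f (r, s)" using that S(1) by (simp add: if_distrib[of "\<lambda>x. x * _"] cong: if_cong)
    finally show ?thesis by simp
  qed
  note hull = is_subfield_hull_subring[of "M \<union> z ` ?Z"] is_subfield_hull_subring[of "M \<union> f ` ?F"]
  show "is_subfield hull (M \<union> z ` ?Z) = is_subfield hull (M \<union> f ` ?F)"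
  proof
    have "z (r, i) \<in> is_subfield hull (M \<union> f ` ?F)" if "r \<in> R" for r i
      unfolding z[OF that]
      by (intro subring_set_sum hull subring_setD(4) subring_set_power)
        (use that S(3) in \<open>auto intro: hull_inc\<close>)
    then show "is_subfield hull (M \<union> z ` ?Z) \<subseteq> is_subfield hull (M \<union> f ` ?F)"
      by (intro hull_minimal) (auto intro: hull_inc is_subfield_hull)
    have "f (r, s) \<in> is_subfield hull (M \<union> z ` ?Z)" if "r \<in> R" "s \<in> S" for r s
      unfolding f[OF that]
      by (intro subring_set_sum hull subring_setD(4)) (use that B(1) in \<open>auto intro: hull_inc\<close>)
    then show "is_subfield hull (M \<union> f ` ?F) \<subseteq> is_subfield hull (M \<union> z ` ?Z)"
      by (intro hull_minimal) (auto intro: hull_inc is_subfield_hull)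
  qed
  assume indep: "indep M ?F f"
  define q :: "'r \<times> nat \<Rightarrow> ('r \<times> 's, 'b) mpoly" where
    "q = (\<lambda>(r, i). \<Sum>s\<in>S. PConst (a s ^ i) * PVar (r, s))"
  define p :: "'r \<times> 's \<Rightarrow> ('r \<times> nat, 'b) mpoly" where
    "p = (\<lambda>(r, s). \<Sum>i<card S. PConst (B s i) * PVar (r, i))"
  have in_P: "PConst (a s ^ i) \<in> polys_over M ?F" "PVar (r, s) \<in> polys_over M ?F" if "s \<in> S" "r \<in> R" for r s i
    using that S(3) by (auto intro!: PConst_in PVar_in subring_setD[OF MR] subring_set_power[OF MR])
  note P = subring_set_polys_over[OF MR, of ?F]
  show "indep M ?Z z"
  proof (rule indep_subst[OF M indep, of ?Z q p z])
    fix w assume "w \<in> ?Z"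
    then obtain r i where w: "w = (r, i)" "r \<in> R" "i < card S" by auto
    show "q w \<in> polys_over M ?F"
      unfolding q_def w(1) by (auto intro!: subring_set_sum[OF P] subring_setD[OF P] in_P w)
    \<comment> \<open>\<open>b\<close> is general because the value is needed twice: with
      coefficient map \<open>id\<close> at \<open>f\<close>, and with \<open>PConst\<close> at
      \<open>p\<close>.\<close>
    have eval: "poly_eval b x (q w) = (\<Sum>s\<in>S. b (a s ^ i) * x (r, s))" if b: "hom_on M b"
      for b :: "'b \<Rightarrow> 'd::comm_ring_1" and x
    proof -
      have "poly_eval b x (q w) = (\<Sum>s\<in>S. poly_eval b x (PConst (a s ^ i) * PVar (r, s)))"
        unfolding q_def w(1) prod.case
        by (rule poly_eval_sum_on[OF MR b, of _ _ ?F]) (auto intro!: subring_setD[OF P] in_P w)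
      also have "\<dots> = (\<Sum>s\<in>S. b (a s ^ i) * x (r, s))"
        using b hom_on_0[OF MR b] by (intro sum.cong refl, subst poly_eval_mult_on[OF MR b, of _ ?F])
          (auto intro!: in_P w simp: poly_eval_PConst poly_eval_PVar hom_on_def)
      finally show ?thesis .
    qed
    show "z w = poly_eval id f (q w)"
      unfolding eval[OF hom_on_id(1)] using w by (simp add: z)
    have "poly_eval PConst p (q w) = (\<Sum>s\<in>S. \<Sum>j<card S. PConst (a s ^ i) * (PConst (B s j) * PVar (r, j)))"
      by (simp add: eval hom_on_PConst p_def sum_distrib_left)
    also have "\<dots> = (\<Sum>j<card S. \<Sum>s\<in>S. PConst (a s ^ i) * (PConst (B s j) * PVar (r, j)))"
      by (rule sum.swap)
    also have "\<dots> = (\<Sum>j<card S. PConst (\<Sum>s\<in>S. a s ^ i * B s j) * PVar (r, j))"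
      by (simp add: hom_on_sum[OF subring_set_UNIV hom_on_PConst] sum_distrib_right mult.assoc PConst_mult)
    also have "\<dots> = (\<Sum>j<card S. if i = j then PVar (r, j) else 0)"
      using w(3) by (intro sum.cong) (auto simp: B(3) PConst_1)
    also have "\<dots> = PVar w" using w by simp
    finally show "poly_eval PConst p (q w) = PVar w" .
  qed
qed

section \<open>Elements with distinct conjugates\<close>

text \<open>The multiplicative group of a finite field is cyclic. The type is wrapped into the ring
  record \<open>?R\<close>, to which the theorem about \<open>mult_of\<close> applies.\<close>

lemma finite_field_primitive_root:
  assumes "finite (UNIV :: 'a::field set)"
  obtains \<theta> :: "'a::field" where "\<And>x. x \<noteq> 0 \<Longrightarrow> \<exists>n::nat. x = \<theta> ^ n"
proof -
  let ?R = "\<lparr>carrier = UNIV, monoid.mult = (*), one = 1, ring.zero = 0, add = (+)\<rparr> :: 'a ring"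
  have "cring ?R"
    by (intro cringI abelian_groupI comm_monoidI)
      (auto simp: algebra_simps intro: exI[where x = "- _"] add.left_inverse)
  moreover have "\<exists>y. y * x = 1 \<and> x * y = 1" if "x \<noteq> 0" for x :: 'a
    using left_inverse[OF that] right_inverse[OF that] by blast
  ultimately interpret R: field ?R
    by (intro cring.cring_fieldI) (auto simp: Units_def)
  have pow: "a [^]\<^bsub>?R\<^esub> (n::nat) = a ^ n" for a :: 'a and n
    by (induction n) (simp_all add: mult.commute)
  have carrier: "carrier (Multiplicative_Group.mult_of ?R) = UNIV - {0}"
    by simp
  have "finite (carrier ?R)" using assms by simp
  from R.finite_field_mult_group_has_gen[OF this] obtain \<theta> :: 'a
    where \<theta>: "UNIV - {0} = {\<theta> ^ n | n::nat. n \<in> UNIV}"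
    unfolding pow carrier by (elim bexE)
  have "\<exists>n::nat. x = \<theta> ^ n" if "x \<noteq> 0" for x
    using that equalityD1[OF \<theta>] by auto
  then show ?thesis by (rule that)
qed

text \<open>
  Over an infinite field, specialise the generic combination \<open>\<Sum>b\<in>B. b * s ^ e b\<close> of a
  spanning set \<open>B\<close>; a finite field is generated by a primitive root.
\<close>

lemma exists_distinct_conjugates:
  fixes \<sigma> :: "'i \<Rightarrow> 'a::field \<Rightarrow> 'a"
  assumes I: "finite I" and \<sigma>: "\<And>i. i \<in> I \<Longrightarrow> field_hom (\<sigma> i)" and inj: "inj_on \<sigma> I"
    and k: "\<And>i c. i \<in> I \<Longrightarrow> c \<in> k \<Longrightarrow> \<sigma> i c = c" and deg: "finite_degree k (UNIV :: 'a set)"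
  obtains \<theta> where "inj_on (\<lambda>i. \<sigma> i \<theta>) I"
proof (cases "finite (UNIV :: 'a set)")
  case True
  from finite_field_primitive_root[OF this] obtain \<theta> :: 'a
    where \<theta>: "\<And>x. x \<noteq> 0 \<Longrightarrow> \<exists>n::nat. x = \<theta> ^ n"
    by blast
  have "inj_on (\<lambda>i. \<sigma> i \<theta>) I"
  proof (rule inj_onI)
    fix i j assume ij: "i \<in> I" "j \<in> I" and eq: "\<sigma> i \<theta> = \<sigma> j \<theta>"
    have "\<sigma> i x = \<sigma> j x" for x
    proof (cases "x = 0")
      case False
      then obtain n where "x = \<theta> ^ n" using \<theta> by blast
      then show ?thesis
        using ij eq by (simp add: hom_on_power[OF subring_set_UNIV hom_on_field_hom[OF \<sigma>]])
    qed (use ij in \<open>simp add: field_homD[OF \<sigma>]\<close>)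
    with inj ij show "i = j" by (auto simp: inj_on_def)
  qed
  then show ?thesis by (rule that)
next
  case infinite: False
  from deg obtain B where B: "finite B" "\<And>x. \<exists>c. (\<forall>b\<in>B. c b \<in> k) \<and> x = (\<Sum>b\<in>B. c b * b)"
    by (auto simp: finite_degree_def)
  \<comment> \<open>A finite \<open>k\<close> would leave only finitely many combinations of the
    finite spanning set, hence a finite field.\<close>
  have "infinite k"
  proof
    assume "finite k"
    have "(UNIV :: 'a set) \<subseteq> (\<lambda>c. \<Sum>b\<in>B. c b * b) ` (B \<rightarrow>\<^sub>E k)"
    proof
      fix x :: 'a
      from B(2) obtain c where "\<forall>b\<in>B. c b \<in> k" "x = (\<Sum>b\<in>B. c b * b)" by blast
      then show "x \<in> (\<lambda>c. \<Sum>b\<in>B. c b * b) ` (B \<rightarrow>\<^sub>E k)"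
        by (intro image_eqI[of _ _ "restrict c B"]) auto
    qed
    with infinite B(1) \<open>finite k\<close> show False
      using finite_subset[OF _ finite_imageI[OF finite_PiE]] by blast
  qed
  from ex_bij_betw_finite_nat[OF B(1)] obtain e where "bij_betw e B {0..<card B}" by blast
  then have e: "inj_on e B" by (simp add: bij_betw_def)
  \<comment> \<open>For \<open>s\<close> in \<open>k\<close>, the value of \<open>D i j\<close> at
    \<open>s\<close> is the difference of the images of \<open>\<Sum>b\<in>B. b * s ^ e b\<close>
    under \<open>\<sigma> i\<close> and \<open>\<sigma> j\<close>. As \<open>e\<close> is injective,
    each \<open>b\<close> has its own coefficient, and all of them vanish only if the two maps agree
    on the spanning set.\<close>
  define D where "D i j = (\<Sum>b\<in>B. Polynomial.monom (\<sigma> i b - \<sigma> j b) (e b))" for i j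
  have D: "D i j \<noteq> 0" if ij: "i \<in> I" "j \<in> I" "i \<noteq> j" for i j
  proof
    assume "D i j = 0"
    have eq_B: "\<sigma> i b = \<sigma> j b" if b: "b \<in> B" for b
    proof -
      have "Polynomial.coeff (D i j) (e b) = (\<Sum>b'\<in>B. if b' = b then \<sigma> i b' - \<sigma> j b' else 0)"
        unfolding D_def coeff_sum
        by (intro sum.cong refl) (use b in \<open>simp add: inj_on_eq_iff[OF e]\<close>)
      then have "(\<Sum>b'\<in>B. if b' = b then \<sigma> i b' - \<sigma> j b' else 0) = 0"
        by (simp add: \<open>D i j = 0\<close>)
      then show ?thesis using b B(1) by simp
    qed
    have "\<sigma> i x = \<sigma> j x" for x
    proof -
      from B(2)[of x] obtain c where c: "\<forall>b\<in>B. c b \<in> k" "x = (\<Sum>b\<in>B. c b * b)" by blast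
      have "\<sigma> l x = (\<Sum>b\<in>B. c b * \<sigma> l b)" if "l \<in> I" for l
        unfolding c(2) hom_on_sum[OF subring_set_UNIV hom_on_field_hom[OF \<sigma>[OF that]] UNIV_I]
        using c(1) k[OF that] by (intro sum.cong refl) (simp add: field_homD[OF \<sigma>[OF that]])
      then show ?thesis using ij eq_B by simp
    qed
    with inj ij show False by (auto simp: inj_on_def)
  qed
  have "finite (\<Union>i\<in>I. \<Union>j\<in>I - {i}. {s. poly (D i j) s = 0})"
    using I D by (auto intro!: poly_roots_finite)
  from Diff_infinite_finite[OF this \<open>infinite k\<close>]
  have "k - (\<Union>i\<in>I. \<Union>j\<in>I - {i}. {s. poly (D i j) s = 0}) \<noteq> {}"
    by (rule infinite_imp_nonempty)
  then obtain s where s: "s \<in> k" "s \<notin> (\<Union>i\<in>I. \<Union>j\<in>I - {i}. {s. poly (D i j) s = 0})"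
    by blast
  have "inj_on (\<lambda>i. \<sigma> i (\<Sum>b\<in>B. b * s ^ e b)) I"
  proof (rule inj_onI, rule ccontr)
    fix i j assume ij: "i \<in> I" "j \<in> I" and eq: "\<sigma> i (\<Sum>b\<in>B. b * s ^ e b) = \<sigma> j (\<Sum>b\<in>B. b * s ^ e b)"
      and "i \<noteq> j"
    have "\<sigma> i (\<Sum>b\<in>B. b * s ^ e b) = (\<Sum>b\<in>B. \<sigma> i b * s ^ e b)" if "i \<in> I" for i
      using that s(1) k
      by (simp add: hom_on_sum[OF subring_set_UNIV hom_on_field_hom[OF \<sigma>]] field_homD[OF \<sigma>]
          hom_on_power[OF subring_set_UNIV hom_on_field_hom[OF \<sigma>]])
    with eq ij have "poly (D i j) s = 0"
      by (simp add: D_def poly_sum poly_monom left_diff_distrib sum_subtractf)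
    with s(2) ij \<open>i \<noteq> j\<close> show False by auto
  qed
  then show ?thesis by (rule that)
qed

section \<open>Rational function fields\<close>

text \<open>Here the coefficients are constants of the function field, whereas
  \<open>poly_eval_Var_nonzero\<close> takes coefficients in the field itself and wrapped
  indeterminates. So \<open>p\<close> is translated into such a \<open>q\<close>, which is zero by
  that lemma for the identity substitution, and translated back.\<close>

lemma indep_Var: "indep (range (Const :: 'a::field \<Rightarrow> ('v, 'a) ratfun)) UNIV Var"
  unfolding indep_def
proof (intro ballI impI)
  let ?C = "Const :: 'a \<Rightarrow> ('v, 'a) ratfun"
  fix p assume p: "p \<in> polys_over (range ?C) UNIV" "poly_eval id Var p = 0"
  have inj: "inj ?C" by (rule field_hom_inj[OF field_hom_Const])
  define q where "q = poly_eval (PConst \<circ> inv_into UNIV ?C) (\<lambda>v. PVar (Indet v)) p"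
  note homC = hom_on_field_hom[OF field_hom_Const, where R = UNIV]
  have "poly_eval ?C (Var \<circ> unindet) q =
      poly_eval (poly_eval ?C (Var \<circ> unindet) \<circ> (PConst \<circ> inv_into UNIV ?C)) (poly_eval ?C (Var \<circ> unindet) \<circ> (\<lambda>v. PVar (Indet v))) p"
    unfolding q_def
    by (rule hom_on_poly_eval_comp[OF subring_set_UNIV hom_on_poly_eval[OF subring_set_UNIV homC,
          where X = UNIV, unfolded polys_over_UNIV] p(1)]) auto
  also have "\<dots> = poly_eval id Var p"
    by (rule poly_eval_cong[OF p(1)])
      (auto simp: poly_eval_PConst poly_eval_PVar field_homD[OF field_hom_Const] inv_f_f[OF inj])
  finally have "poly_eval ?C (Var \<circ> unindet) q = 0" using p(2) by simp
  moreover have "field_hom (\<lambda>x::'a. x)" by (simp add: field_hom_def)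
  ultimately have "q = 0"
    using poly_eval_Var_nonzero[of "\<lambda>x. x" "\<lambda>v::'v. v" q] by (auto simp: o_def inj_on_def)
  have homPC: "hom_on UNIV (PConst \<circ> ?C)" by (rule hom_on_PConst_comp[OF homC])
  have "0 = poly_eval (PConst \<circ> ?C) (PVar \<circ> unindet) q" by (simp add: \<open>q = 0\<close>)
  also have "\<dots> = poly_eval (poly_eval (PConst \<circ> ?C) (PVar \<circ> unindet) \<circ> (PConst \<circ> inv_into UNIV ?C))
      (poly_eval (PConst \<circ> ?C) (PVar \<circ> unindet) \<circ> (\<lambda>v. PVar (Indet v))) p"
    unfolding q_def
    by (rule hom_on_poly_eval_comp[OF subring_set_UNIV hom_on_poly_eval[OF subring_set_UNIV homPC,
          where X = UNIV, unfolded polys_over_UNIV] p(1)]) auto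
  also have "\<dots> = poly_eval PConst PVar p"
    by (rule poly_eval_cong[OF p(1)])
      (auto simp: poly_eval_PConst poly_eval_PVar field_homD[OF field_hom_Const] inv_f_f[OF inj] PConst_1)
  finally show "p = 0" by (simp add: poly_eval_PConst_PVar)
qed

lemma is_subfield_Const_image: "is_subfield k \<Longrightarrow> is_subfield (Const ` k)"
  by (rule hom_on_image_subfield[OF is_subfield_UNIV hom_on_field_hom[OF field_hom_Const]]) auto

lemma hom_on_inv_into:
  fixes \<tau> :: "'a::field \<Rightarrow> 'b::field"
  assumes F: "is_subfield F" and \<tau>: "hom_on F \<tau>"
  shows "hom_on (\<tau> ` F) (inv_into F \<tau>)"
proof -
  note inv = inv_into_f_f[OF hom_on_inj[OF F \<tau>]]
  have "inv_into F \<tau> (\<tau> 1) = 1" by (rule inv) (rule is_subfieldD[OF F])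
  moreover have "inv_into F \<tau> (\<tau> x + \<tau> y) = x + y" "inv_into F \<tau> (\<tau> x * \<tau> y) = x * y"
    if "x \<in> F" "y \<in> F" for x y
    using inv[of "x + y"] inv[of "x * y"] \<tau> that by (auto simp: hom_on_def is_subfieldD[OF F])
  ultimately show ?thesis
    using \<tau> inv by (auto simp: hom_on_def)
qed

lemma field_actionD:
  assumes "group G" and F: "is_subfield F" and act: "field_action G F \<phi>"
  shows "g \<in> carrier G \<Longrightarrow> hom_on F (\<phi> g)"
    and "g \<in> carrier G \<Longrightarrow> x \<in> F \<Longrightarrow> \<phi> g x \<in> F"
    and "g \<in> carrier G \<Longrightarrow> h \<in> carrier G \<Longrightarrow> x \<in> F \<Longrightarrow> \<phi> (g \<otimes>\<^bsub>G\<^esub> h) x = \<phi> g (\<phi> h x)"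
    and "x \<in> F \<Longrightarrow> \<phi> \<one>\<^bsub>G\<^esub> x = x"
proof -
  interpret group G by fact
  have Bij: "\<phi> g \<in> Bij F" and hom: "\<phi> g \<in> carrier (field_aut_group F {})" if "g \<in> carrier G" for g
    using act that by (auto simp: field_action_def hom_def field_aut_group_def)
  show "hom_on F (\<phi> g)" if "g \<in> carrier G" for g
    using hom[OF that] by (auto simp: field_aut_group_def hom_on_def)
  show closed: "\<phi> g x \<in> F" if "g \<in> carrier G" "x \<in> F" for g x
    using Bij[OF that(1)] that(2) by (auto simp: Bij_def bij_betw_def)
  show mult: "\<phi> (g \<otimes>\<^bsub>G\<^esub> h) x = \<phi> g (\<phi> h x)" if "g \<in> carrier G" "h \<in> carrier G" "x \<in> F" for g h x
  proof -
    have "\<phi> (g \<otimes>\<^bsub>G\<^esub> h) = \<phi> g \<otimes>\<^bsub>field_aut_group F {}\<^esub> \<phi> h"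
      using act that by (auto simp: field_action_def hom_def)
    then show ?thesis using that Bij by (simp add: field_aut_group_def BijGroup_def compose_def)
  qed
  show "\<phi> \<one>\<^bsub>G\<^esub> x = x" if "x \<in> F"
  proof -
    \<comment> \<open>By multiplicativity \<open>\<phi> \<one>\<close> is idempotent, and an
      injective idempotent map is the identity.\<close>
    have "inj_on (\<phi> \<one>\<^bsub>G\<^esub>) F" using Bij[OF one_closed] by (auto simp: Bij_def bij_betw_def)
    moreover have "\<phi> \<one>\<^bsub>G\<^esub> (\<phi> \<one>\<^bsub>G\<^esub> x) = \<phi> \<one>\<^bsub>G\<^esub> x"
      using mult[OF one_closed one_closed that] by simp
    ultimately show ?thesis using that closed[OF one_closed that] by (auto dest: inj_onD)
  qed
qed

section \<open>The fixed field of a direct product\<close>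

lemma bij_left_mult:
  assumes "group H" "h \<in> carrier H"
  shows "bij_betw (\<lambda>g. h \<otimes>\<^bsub>H\<^esub> g) (carrier H) (carrier H)"
proof -
  interpret group H by fact
  show ?thesis
    by (rule bij_betw_byWitness[where f' = "\<lambda>g. inv\<^bsub>H\<^esub> h \<otimes>\<^bsub>H\<^esub> g"])
      (use assms(2) in \<open>auto simp flip: m_assoc\<close>)
qed

text \<open>Fixes the data of the theorem once, so that the constructed elements can be named and
  shared by both implications. K is the whole type \<open>'K\<close>; its base field is a
  subset.\<close>

locale product_action =
  fixes G1 :: "('g1, 'm1) monoid_scheme" and G2 :: "('g2, 'm2) monoid_scheme"
    and act :: "'g1 \<times> 'g2 \<Rightarrow> 'K::field \<Rightarrow> 'K" and k :: "'K set"
    and \<phi> :: "'g1 \<times> 'g2 \<Rightarrow> ('g1 \<times> 'g2, 'K) ratfun \<Rightarrow> ('g1 \<times> 'g2, 'K) ratfun"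
  assumes G1: "group G1" and G2: "group G2"
    and finite_G: "finite (carrier (G1 \<times>\<times> G2))"
    and action: "field_action (G1 \<times>\<times> G2) UNIV act"
    and k_def: "k = fixed_field (G1 \<times>\<times> G2) UNIV act"
    and degree: "finite_degree k UNIV"
    and kernel: "kernel (G1 \<times>\<times> G2) (field_aut_group UNIV k) act = carrier G1 \<times> {\<one>\<^bsub>G2\<^esub>}"
    and translation: "extends_by_translation (G1 \<times>\<times> G2) UNIV act \<phi>"
begin

section \<open>The two factors acting on K\<close>

abbreviation "C1 \<equiv> carrier G1"
abbreviation "C2 \<equiv> carrier G2"

lemma carriers: "\<one>\<^bsub>G1\<^esub> \<in> C1" "\<one>\<^bsub>G2\<^esub> \<in> C2" "finite C1" "finite C2"
proof -
  show *: "\<one>\<^bsub>G1\<^esub> \<in> C1" "\<one>\<^bsub>G2\<^esub> \<in> C2"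
    by (rule monoid.one_closed[OF group.is_monoid[OF G1]] monoid.one_closed[OF group.is_monoid[OF G2]])+
  show "finite C1" "finite C2"
    using finite_G * finite_cartesian_productD1[of C1 C2] finite_cartesian_productD2[of C1 C2] by auto
qed

lemma group_G: "group (G1 \<times>\<times> G2)"
  by (rule DirProd_group[OF G1 G2])

lemma left_mult_closed: "h \<in> C1 \<Longrightarrow> h' \<in> C1 \<Longrightarrow> h \<otimes>\<^bsub>G1\<^esub> h' \<in> C1" "g \<in> C2 \<Longrightarrow> g' \<in> C2 \<Longrightarrow> g \<otimes>\<^bsub>G2\<^esub> g' \<in> C2"
  using monoid.m_closed[OF group.is_monoid[OF G1]] monoid.m_closed[OF group.is_monoid[OF G2]] by auto

lemma one_mult: "h \<in> C1 \<Longrightarrow> h \<otimes>\<^bsub>G1\<^esub> \<one>\<^bsub>G1\<^esub> = h" "g \<in> C2 \<Longrightarrow> \<one>\<^bsub>G2\<^esub> \<otimes>\<^bsub>G2\<^esub> g = g"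
  "h \<in> C1 \<Longrightarrow> \<one>\<^bsub>G1\<^esub> \<otimes>\<^bsub>G1\<^esub> h = h"
  using monoid.r_one[OF group.is_monoid[OF G1]] monoid.l_one[OF group.is_monoid[OF G2]]
    monoid.l_one[OF group.is_monoid[OF G1]] by auto

lemma act_hom: "h \<in> C1 \<Longrightarrow> g \<in> C2 \<Longrightarrow> field_hom (act (h, g))"
  using field_actionD(1)[OF group_G is_subfield_UNIV action, of "(h, g)"] by (simp add: hom_on_def field_hom_def)

lemma act_mult:
  "h \<in> C1 \<Longrightarrow> g \<in> C2 \<Longrightarrow> h' \<in> C1 \<Longrightarrow> g' \<in> C2 \<Longrightarrow>
    act (h \<otimes>\<^bsub>G1\<^esub> h', g \<otimes>\<^bsub>G2\<^esub> g') c = act (h, g) (act (h', g') c)"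
  using field_actionD(3)[OF group_G is_subfield_UNIV action, of "(h, g)" "(h', g')" c] by simp

text \<open>Expresses the kernel hypothesis through maps: the unit of
  \<open>field_aut_group UNIV k\<close> is the identity, as there is nothing outside
  \<open>UNIV\<close> to normalize.\<close>

lemma act_id_iff: "h \<in> C1 \<Longrightarrow> g \<in> C2 \<Longrightarrow> act (h, g) = id \<longleftrightarrow> g = \<one>\<^bsub>G2\<^esub>"
proof -
  assume hg: "h \<in> C1" "g \<in> C2"
  have one: "\<one>\<^bsub>field_aut_group UNIV k\<^esub> = id" by (auto simp: field_aut_group_def BijGroup_def)
  have "(h, g) \<in> kernel (G1 \<times>\<times> G2) (field_aut_group UNIV k) act \<longleftrightarrow> act (h, g) = id"
    using hg by (simp add: kernel_def one)
  then show ?thesis using hg by (simp add: kernel)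
qed

lemma act_G1: "h \<in> C1 \<Longrightarrow> act (h, \<one>\<^bsub>G2\<^esub>) c = c"
  using act_id_iff[of h "\<one>\<^bsub>G2\<^esub>"] carriers by simp

text \<open>Since \<open>(h, g)\<close> is the product of \<open>(h, 1)\<close> and
  \<open>(1, g)\<close>, the action on K factors through \<open>G2\<close>.\<close>

lemma act_eq: "h \<in> C1 \<Longrightarrow> g \<in> C2 \<Longrightarrow> act (h, g) c = act (\<one>\<^bsub>G1\<^esub>, g) c"
  using act_mult[of h "\<one>\<^bsub>G2\<^esub>" "\<one>\<^bsub>G1\<^esub>" g c] carriers by (simp add: act_G1 one_mult)

text \<open>If \<open>g\<close> and \<open>g'\<close> act alike, the quotient of the two acts
  trivially and is the unit by \<open>act_id_iff\<close>. This faithfulness is what yields distinct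
  conjugates.\<close>

lemma inj_on_act: "inj_on (\<lambda>g. act (\<one>\<^bsub>G1\<^esub>, g)) C2"
proof (rule inj_onI)
  interpret G2: group G2 by (rule G2)
  fix g g' assume g: "g \<in> C2" "g' \<in> C2" "act (\<one>\<^bsub>G1\<^esub>, g) = act (\<one>\<^bsub>G1\<^esub>, g')"
  have "act (\<one>\<^bsub>G1\<^esub>, inv\<^bsub>G2\<^esub> g' \<otimes>\<^bsub>G2\<^esub> g) c = c" for c
  proof -
    have "act (\<one>\<^bsub>G1\<^esub>, inv\<^bsub>G2\<^esub> g' \<otimes>\<^bsub>G2\<^esub> x) c = act (\<one>\<^bsub>G1\<^esub>, inv\<^bsub>G2\<^esub> g') (act (\<one>\<^bsub>G1\<^esub>, x) c)"
      if "x \<in> C2" for x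
      using act_mult[of "\<one>\<^bsub>G1\<^esub>" "inv\<^bsub>G2\<^esub> g'" "\<one>\<^bsub>G1\<^esub>" x c] that g carriers by (simp add: one_mult)
    from this[OF g(1)] this[OF g(2)] g(3)
    have "act (\<one>\<^bsub>G1\<^esub>, inv\<^bsub>G2\<^esub> g' \<otimes>\<^bsub>G2\<^esub> g) c = act (\<one>\<^bsub>G1\<^esub>, inv\<^bsub>G2\<^esub> g' \<otimes>\<^bsub>G2\<^esub> g') c"
      by metis
    then show ?thesis using g carriers by (simp add: act_G1)
  qed
  then have "act (\<one>\<^bsub>G1\<^esub>, inv\<^bsub>G2\<^esub> g' \<otimes>\<^bsub>G2\<^esub> g) = id" by auto
  then have "inv\<^bsub>G2\<^esub> g' \<otimes>\<^bsub>G2\<^esub> g = \<one>\<^bsub>G2\<^esub>" using g carriers by (subst (asm) act_id_iff) auto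
  then show "g = g'" using g by (metis G2.inv_closed G2.inv_equality G2.inv_inv)
qed

lemma k_iff: "c \<in> k \<longleftrightarrow> (\<forall>g\<in>C2. act (\<one>\<^bsub>G1\<^esub>, g) c = c)"
proof -
  have "c \<in> k \<longleftrightarrow> (\<forall>h\<in>C1. \<forall>g\<in>C2. act (h, g) c = c)"
    unfolding k_def fixed_field_def by auto
  then show ?thesis using carriers act_eq by metis
qed

lemma subfield_k: "is_subfield k"
  unfolding k_def by (rule fixed_field_subfield[OF is_subfield_UNIV field_actionD(1)[OF group_G is_subfield_UNIV action]])

section \<open>The rational function field, its constants and its group action\<close>

abbreviation Kc :: "('g1 \<times> 'g2, 'K) ratfun set" where "Kc \<equiv> range Const"
abbreviation kc :: "('g1 \<times> 'g2, 'K) ratfun set" where "kc \<equiv> Const ` k"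
abbreviation E :: "('g1 \<times> 'g2, 'K) ratfun set" where "E \<equiv> ratfun_field UNIV (C1 \<times> C2)"

lemma subfield_Kc: "is_subfield Kc" and subfield_kc: "is_subfield kc"
  by (rule is_subfield_Const_image is_subfield_UNIV subfield_k)+

lemma subfield_E: "is_subfield E"
  unfolding ratfun_field_def by (rule is_subfield_hull)

lemma Kc_E: "Kc \<subseteq> E"
  by (auto intro: ratfun_field_gens)

lemma Var_E: "x \<in> C1 \<Longrightarrow> y \<in> C2 \<Longrightarrow> Var (x, y) \<in> E"
  by (auto intro: ratfun_field_gens)

lemma \<phi>_hom: "h \<in> C1 \<Longrightarrow> g \<in> C2 \<Longrightarrow> hom_on E (\<phi> (h, g))"
  and \<phi>_mult: "h \<in> C1 \<Longrightarrow> g \<in> C2 \<Longrightarrow> h' \<in> C1 \<Longrightarrow> g' \<in> C2 \<Longrightarrow> x \<in> E \<Longrightarrow>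
    \<phi> (h \<otimes>\<^bsub>G1\<^esub> h', g \<otimes>\<^bsub>G2\<^esub> g') x = \<phi> (h, g) (\<phi> (h', g') x)"
  and \<phi>_one: "x \<in> E \<Longrightarrow> \<phi> (\<one>\<^bsub>G1\<^esub>, \<one>\<^bsub>G2\<^esub>) x = x"
  and \<phi>_Const: "h \<in> C1 \<Longrightarrow> g \<in> C2 \<Longrightarrow> \<phi> (h, g) (Const c) = Const (act (h, g) c)"
  and \<phi>_Var: "h \<in> C1 \<Longrightarrow> g \<in> C2 \<Longrightarrow> h' \<in> C1 \<Longrightarrow> g' \<in> C2 \<Longrightarrow>
    \<phi> (h, g) (Var (h', g')) = Var (h \<otimes>\<^bsub>G1\<^esub> h', g \<otimes>\<^bsub>G2\<^esub> g')"
proof -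
  have act: "field_action (G1 \<times>\<times> G2) E \<phi>"
    using translation by (simp add: extends_by_translation_def)
  note act = field_actionD[OF group_G subfield_E act]
  show "h \<in> C1 \<Longrightarrow> g \<in> C2 \<Longrightarrow> hom_on E (\<phi> (h, g))" by (rule act(1)) simp
  show "h \<in> C1 \<Longrightarrow> g \<in> C2 \<Longrightarrow> h' \<in> C1 \<Longrightarrow> g' \<in> C2 \<Longrightarrow> x \<in> E \<Longrightarrow>
    \<phi> (h \<otimes>\<^bsub>G1\<^esub> h', g \<otimes>\<^bsub>G2\<^esub> g') x = \<phi> (h, g) (\<phi> (h', g') x)"
    using act(3)[of "(h, g)" "(h', g')" x] by simp
  show "x \<in> E \<Longrightarrow> \<phi> (\<one>\<^bsub>G1\<^esub>, \<one>\<^bsub>G2\<^esub>) x = x" using act(4)[of x] by simp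
  show "h \<in> C1 \<Longrightarrow> g \<in> C2 \<Longrightarrow> \<phi> (h, g) (Const c) = Const (act (h, g) c)"
    "h \<in> C1 \<Longrightarrow> g \<in> C2 \<Longrightarrow> h' \<in> C1 \<Longrightarrow> g' \<in> C2 \<Longrightarrow>
    \<phi> (h, g) (Var (h', g')) = Var (h \<otimes>\<^bsub>G1\<^esub> h', g \<otimes>\<^bsub>G2\<^esub> g')"
    using translation by (auto simp: extends_by_translation_def)
qed

section \<open>The two Vandermonde substitutions\<close>

definition \<theta> :: 'K where "\<theta> = (SOME \<theta>. inj_on (\<lambda>g. act (\<one>\<^bsub>G1\<^esub>, g) \<theta>) C2)"

lemma inj_on_\<theta>: "inj_on (\<lambda>g. act (\<one>\<^bsub>G1\<^esub>, g) \<theta>) C2"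
proof -
  have "act (\<one>\<^bsub>G1\<^esub>, g) c = c" if "g \<in> C2" "c \<in> k" for g c
    using that k_iff by blast
  from exists_distinct_conjugates[OF carriers(4) act_hom[OF carriers(1)] inj_on_act this degree]
  obtain \<eta> where "inj_on (\<lambda>g. act (\<one>\<^bsub>G1\<^esub>, g) \<eta>) C2" by blast
  then show ?thesis unfolding \<theta>_def by (rule someI)
qed

definition z :: "'g1 \<times> nat \<Rightarrow> ('g1 \<times> 'g2, 'K) ratfun" where
  "z = (\<lambda>(h, i). \<Sum>g\<in>C2. Const (act (\<one>\<^bsub>G1\<^esub>, g) \<theta>) ^ i * Var (h, g))"

text \<open>One Vandermonde system for each \<open>h\<close> in \<open>C1\<close>, all with the
  conjugates of \<open>\<theta>\<close> as nodes; these stay distinct under the injective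
  \<open>Const\<close>.\<close>

lemma hull_z: "is_subfield hull (Kc \<union> z ` (C1 \<times> {..<card C2})) = E"
  and indep_z: "indep Kc (C1 \<times> {..<card C2}) z"
proof -
  have inj: "inj_on (\<lambda>g. Const (act (\<one>\<^bsub>G1\<^esub>, g) \<theta>) :: ('g1 \<times> 'g2, 'K) ratfun) C2"
    using comp_inj_on[OF inj_on_\<theta> inj_on_subset[OF field_hom_inj[OF field_hom_Const]]] by (simp add: o_def)
  note V = indep_vandermonde[OF subfield_Kc carriers(4) inj, where f = Var and z = z and R = C1]
  show "is_subfield hull (Kc \<union> z ` (C1 \<times> {..<card C2})) = E"
    unfolding ratfun_field_def by (rule V) (auto simp: z_def)
  show "indep Kc (C1 \<times> {..<card C2}) z"
    by (rule V) (auto simp: z_def intro: indep_mono[OF indep_Var])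
qed

lemma z_E: "h \<in> C1 \<Longrightarrow> z (h, i) \<in> E"
  unfolding z_def prod.case
  by (intro subring_set_sum subring_setD(4) subring_set_power is_subfield_subring[OF subfield_E] Var_E)
    (use Kc_E in auto)

text \<open>The element \<open>g\<close> shifts the node and the second index of the indeterminate
  by the same left translation, so it disappears by reindexing; only \<open>h\<close> remains
  visible.\<close>

lemma \<phi>_z:
  assumes "h \<in> C1" "g \<in> C2" "h' \<in> C1"
  shows "\<phi> (h, g) (z (h', i)) = z (h \<otimes>\<^bsub>G1\<^esub> h', i)"
proof -
  note R = is_subfield_subring[OF subfield_E]
  note hom = \<phi>_hom[OF assms(1,2)]
  have Const_E: "Const c \<in> E" for c using Kc_E by auto
  have "\<phi> (h, g) (z (h', i)) = (\<Sum>g'\<in>C2. \<phi> (h, g) (Const (act (\<one>\<^bsub>G1\<^esub>, g') \<theta>) ^ i * Var (h', g')))"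
    unfolding z_def prod.case
    by (rule hom_on_sum[OF R hom]) (auto intro!: subring_setD(4)[OF R] subring_set_power[OF R] Const_E Var_E assms)
  also have "\<dots> = (\<Sum>g'\<in>C2. Const (act (\<one>\<^bsub>G1\<^esub>, g \<otimes>\<^bsub>G2\<^esub> g') \<theta>) ^ i * Var (h \<otimes>\<^bsub>G1\<^esub> h', g \<otimes>\<^bsub>G2\<^esub> g'))"
  proof (intro sum.cong refl)
    fix g' assume g': "g' \<in> C2"
    have "\<phi> (h, g) (Const (act (\<one>\<^bsub>G1\<^esub>, g') \<theta>) ^ i * Var (h', g')) =
        \<phi> (h, g) (Const (act (\<one>\<^bsub>G1\<^esub>, g') \<theta>)) ^ i * \<phi> (h, g) (Var (h', g'))"
      using hom hom_on_power[OF R hom Const_E] subring_set_power[OF R Const_E] Var_E[OF assms(3) g']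
      by (simp add: hom_on_def)
    \<comment> \<open>The component \<open>h\<close> acts trivially on K, so only \<open>g\<close>
      moves the node.\<close>
    also have "\<phi> (h, g) (Const (act (\<one>\<^bsub>G1\<^esub>, g') \<theta>)) = Const (act (\<one>\<^bsub>G1\<^esub>, g \<otimes>\<^bsub>G2\<^esub> g') \<theta>)"
      using assms g' carriers(1,2)  act_mult[of h g "\<one>\<^bsub>G1\<^esub>" g' \<theta>]
      by (simp add: \<phi>_Const one_mult act_eq[of h] left_mult_closed)
    finally show "\<phi> (h, g) (Const (act (\<one>\<^bsub>G1\<^esub>, g') \<theta>) ^ i * Var (h', g')) =
        Const (act (\<one>\<^bsub>G1\<^esub>, g \<otimes>\<^bsub>G2\<^esub> g') \<theta>) ^ i * Var (h \<otimes>\<^bsub>G1\<^esub> h', g \<otimes>\<^bsub>G2\<^esub> g')"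
      using assms g' by (simp add: \<phi>_Var)
  qed
  also have "\<dots> = z (h \<otimes>\<^bsub>G1\<^esub> h', i)"
    unfolding z_def prod.case
    by (rule sum.reindex_bij_betw[OF bij_left_mult[OF G2 assms(2)]])
  finally show ?thesis .
qed

definition y :: "'g1 \<Rightarrow> ('g1 \<times> 'g2, 'K) ratfun" where "y h = z (h, 0)"

definition L :: "('g1 \<times> 'g2, 'K) ratfun set" where "L = is_subfield hull (Kc \<union> y ` C1)"

definition t :: "nat \<times> nat \<Rightarrow> ('g1 \<times> 'g2, 'K) ratfun" where
  "t = (\<lambda>(j, i). \<Sum>h\<in>C1. y h ^ i * z (h, j))"

text \<open>The index \<open>j = 0\<close> is omitted because \<open>z (h, 0) = y h\<close> already
  lies in \<open>L\<close>.\<close>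

definition T :: "(nat \<times> nat) set" where "T = {1..<card C2} \<times> {..<card C1}"

lemma finite_T: "finite T"
  by (simp add: T_def)

lemma subfield_L: "is_subfield L"
  unfolding L_def by (rule is_subfield_hull)

lemma indep_y: "indep Kc C1 y"
proof -
  have "indep Kc C1 (\<lambda>h. z (h, 0))"
  proof (rule indep_reindex[OF subfield_Kc, where e = "\<lambda>h. (h, 0)" and f = z])
    have "card C2 > 0" using carriers by (auto simp: card_gt_0_iff)
    then show "indep Kc ((\<lambda>h. (h, 0)) ` C1) z"
      by (intro indep_mono[OF indep_z]) auto
  qed (auto intro: inj_onI)
  then show ?thesis by (simp add: y_def[abs_def])
qed

lemma y_L: "h \<in> C1 \<Longrightarrow> y h \<in> L"
  unfolding L_def by (auto intro: hull_inc)

lemma y_E: "h \<in> C1 \<Longrightarrow> y h \<in> E"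
  unfolding y_def by (rule z_E)

lemma L_E: "L \<subseteq> E"
  unfolding L_def by (rule hull_minimal) (use Kc_E y_E subfield_E in auto)

text \<open>The \<open>z (h, j)\<close> with \<open>j \<ge> 1\<close> stay independent after the
  \<open>y h\<close> are adjoined to the base. For each such \<open>j\<close> there is a Vandermonde
  system with nodes \<open>y h\<close>, distinct because they are independent. The pairs are swapped
  so that \<open>h\<close> becomes the index of the nodes and \<open>j\<close> the one that merely
  labels the systems.\<close>

lemma hull_t: "is_subfield hull (L \<union> t ` T) = E"
  and indep_t: "indep L T t"
proof -
  let ?Y = "C1 \<times> {0::nat}" and ?Z = "C1 \<times> {1..<card C2}"
  have "card C2 > 0" using carriers by (auto simp: card_gt_0_iff)
  then have YZ: "C1 \<times> {..<card C2} = ?Y \<union> ?Z" by auto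
  have L: "is_subfield hull (Kc \<union> z ` ?Y) = L"
    by (auto simp: L_def y_def image_def intro!: arg_cong[where f = "(hull) is_subfield"])
  have "indep L ?Z z"
    unfolding L[symmetric]
    by (rule indep_over_hull[OF subfield_Kc _ indep_z[unfolded YZ]]) auto
  then have zL: "indep L ({1..<card C2} \<times> C1) (\<lambda>p. z (prod.swap p))"
    by (intro indep_reindex[OF subfield_L, where e = prod.swap and f = z])
      (simp_all add: product_swap)
  have swap: "(\<lambda>p. z (prod.swap p)) ` ({1..<card C2} \<times> C1) = z ` ?Z"
    by (subst image_image[symmetric]) (simp add: product_swap)
  note V = indep_vandermonde[OF subfield_L carriers(3) indep_inj_on[OF subfield_Kc indep_y],
      where f = "\<lambda>p. z (prod.swap p)" and z = t and R = "{1..<card C2}"]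
  have "is_subfield hull (L \<union> t ` T) = is_subfield hull (L \<union> (\<lambda>p. z (prod.swap p)) ` ({1..<card C2} \<times> C1))"
    unfolding T_def by (rule V) (auto simp: t_def y_L)
  also have "\<dots> = is_subfield hull (Kc \<union> z ` ?Y \<union> z ` ?Z)"
    unfolding swap L[symmetric] by (rule hull_hull_Un)
  also have "\<dots> = E" by (simp only: hull_z[symmetric] YZ image_Un Un_assoc)
  finally show "is_subfield hull (L \<union> t ` T) = E" .
  show "indep L T t" unfolding T_def by (rule V) (use zL in \<open>auto simp: t_def y_L\<close>)
qed

text \<open>\<open>g\<close> fixes every \<open>z\<close>, and \<open>h\<close> translates the nodes
  \<open>y\<close> and the forms \<open>z\<close> together, so the sum is only reindexed.\<close>

lemma \<phi>_t:
  assumes "h \<in> C1" "g \<in> C2"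
  shows "\<phi> (h, g) (t v) = t v"
proof (cases v)
  case (Pair j i)
  note R = is_subfield_subring[OF subfield_E]
  note hom = \<phi>_hom[OF assms]
  have "\<phi> (h, g) (t v) = (\<Sum>h'\<in>C1. \<phi> (h, g) (y h' ^ i * z (h', j)))"
    unfolding t_def Pair prod.case
    by (rule hom_on_sum[OF R hom]) (auto intro!: subring_setD(4)[OF R] subring_set_power[OF R] y_E z_E)
  also have "\<dots> = (\<Sum>h'\<in>C1. y (h \<otimes>\<^bsub>G1\<^esub> h') ^ i * z (h \<otimes>\<^bsub>G1\<^esub> h', j))"
    using hom hom_on_power[OF R hom y_E] subring_set_power[OF R y_E] z_E assms \<phi>_z
    by (intro sum.cong refl) (simp add: hom_on_def y_def)
  also have "\<dots> = t v"
    unfolding t_def Pair prod.case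
    by (rule sum.reindex_bij_betw[OF bij_left_mult[OF G1 assms(1)]])
  finally show ?thesis .
qed

lemma \<phi>_L:
  assumes "h \<in> C1" "g \<in> C2" "x \<in> L"
  shows "\<phi> (h, g) x \<in> L"
proof -
  have "\<phi> (h, g) ` L = is_subfield hull (\<phi> (h, g) ` (Kc \<union> y ` C1))"
    unfolding L_def
    by (rule hom_on_image_hull[OF subfield_E \<phi>_hom[OF assms(1,2)]]) (use Kc_E y_E in auto)
  also have "\<dots> \<subseteq> L"
    unfolding L_def
    by (rule hull_mono) (use assms in \<open>auto simp: \<phi>_Const \<phi>_z y_def left_mult_closed intro!: imageI\<close>)
  finally show ?thesis using assms(3) by auto
qed

section \<open>Fixed fields of the product and of the second factor\<close>

lemma fixed_field_E: "fixed_field (G1 \<times>\<times> G2) E \<phi> = is_subfield hull (fixed_field (G1 \<times>\<times> G2) L \<phi> \<union> t ` T)"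
  unfolding hull_t[symmetric]
  by (rule fixed_field_hull[OF group_G finite_G subfield_L indep_t])
    (unfold hull_t, auto simp: \<phi>_hom \<phi>_mult \<phi>_one \<phi>_L \<phi>_t)

text \<open>The same descent as for \<open>t\<close>, now with the group \<open>G2\<close>, base
  field K and the independent \<open>G2\<close>-invariant elements \<open>y h\<close>; the fixed
  constants are those of \<open>k\<close>.\<close>

lemma fixed_field_L:
  "{x \<in> L. \<forall>g\<in>C2. \<phi> (\<one>\<^bsub>G1\<^esub>, g) x = x} = is_subfield hull (kc \<union> y ` C1)"
proof -
  have "fixed_field G2 Kc (\<lambda>g. \<phi> (\<one>\<^bsub>G1\<^esub>, g)) = kc"
    using carriers(1) k_iff injD[OF field_hom_inj[OF field_hom_Const]]
    by (fastforce simp: fixed_field_def \<phi>_Const)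
  moreover have "fixed_field G2 L (\<lambda>g. \<phi> (\<one>\<^bsub>G1\<^esub>, g)) =
      is_subfield hull (fixed_field G2 Kc (\<lambda>g. \<phi> (\<one>\<^bsub>G1\<^esub>, g)) \<union> y ` C1)"
    unfolding L_def
  proof (rule fixed_field_hull[OF G2 carriers(4) subfield_Kc indep_y], fold L_def)
    fix g h x assume "g \<in> C2" "h \<in> C2" "x \<in> L"
    then show "\<phi> (\<one>\<^bsub>G1\<^esub>, g \<otimes>\<^bsub>G2\<^esub> h) x = \<phi> (\<one>\<^bsub>G1\<^esub>, g) (\<phi> (\<one>\<^bsub>G1\<^esub>, h) x)"
      using \<phi>_mult[of "\<one>\<^bsub>G1\<^esub>" g "\<one>\<^bsub>G1\<^esub>" h x] L_E carriers by (auto simp: one_mult)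
  qed (use L_E carriers \<phi>_one hom_on_subset[OF \<phi>_hom L_E] in \<open>auto simp: \<phi>_Const \<phi>_z y_def one_mult\<close>)
  ultimately show ?thesis by (simp add: fixed_field_def)
qed

section \<open>Comparison with the field k(G1)\<close>

abbreviation N :: "('g1, 'K) ratfun set" where "N \<equiv> noether_field k G1"
abbreviation W :: "('g1, 'K) ratfun set" where "W \<equiv> ratfun_field UNIV C1"
abbreviation V :: "('g1, 'K) ratfun set" where "V \<equiv> ratfun_field k C1"
abbreviation "tr \<equiv> Defs.translation G1 (\<lambda>_ c. c) :: 'g1 \<Rightarrow> ('g1, 'K) ratfun \<Rightarrow> _"

lemma subfield_W: "is_subfield W" and subfield_V: "is_subfield V"
  unfolding ratfun_field_def by (rule is_subfield_hull)+

lemma V_W: "V \<subseteq> W"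
  unfolding ratfun_field_def by (rule hull_mono) auto

lemma tr_simps:
  assumes "h \<in> C1"
  shows "field_hom (tr h)" "tr h (Const c) = Const c" "h' \<in> C1 \<Longrightarrow> tr h (Var h') = Var (h \<otimes>\<^bsub>G1\<^esub> h')"
  using group.translation_props[OF G1, of "\<lambda>_ c. c" h] assms by (auto simp: field_hom_def[of "\<lambda>c. c"])

lemma tr_closed: "h \<in> C1 \<Longrightarrow> x \<in> ratfun_field F C1 \<Longrightarrow> tr h x \<in> ratfun_field F C1"
  unfolding ratfun_field_def
  by (erule field_hom_image_hull[OF tr_simps(1) is_subfield_hull, rotated 2])
    (auto simp: tr_simps left_mult_closed intro!: hull_inc)

lemma subfield_N: "is_subfield N"
  unfolding noether_field_def by (rule fixed_field_subfield[OF subfield_V]) (simp add: hom_on_field_hom tr_simps)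

lemma N_V: "N \<subseteq> V"
  by (auto simp: noether_field_def fixed_field_def)

lemma Const_N: "c \<in> k \<Longrightarrow> Const c \<in> N"
  by (simp add: noether_field_def fixed_field_def tr_simps ratfun_field_gens)

text \<open>\<open>\<tau>\<close> sends the indeterminate of \<open>h\<close> to \<open>y h\<close>,
  which is possible because both families are independent over K. It carries translation by
  \<open>h\<close> to the action of \<open>(h, 1)\<close>, so the image of \<open>N\<close> is the
  \<open>G1\<close>-invariant part of \<open>k(y)\<close>. As \<open>k(y)\<close> is the
  \<open>G2\<close>-invariant part of \<open>L\<close>, this is the fixed field of the whole
  product.\<close>

lemma noether_field_embedding:
  obtains \<tau> where "hom_on W \<tau>" "\<And>c. \<tau> (Const c) = Const c" "\<tau> ` N = fixed_field (G1 \<times>\<times> G2) L \<phi>"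
proof -
  let ?C1 = "Const :: 'K \<Rightarrow> ('g1, 'K) ratfun"
  have inj: "inj ?C1" by (rule field_hom_inj[OF field_hom_Const])
  \<comment> \<open>K sits as constants in two different rational function fields:
    \<open>\<rho>\<close> strips one embedding and applies the other.\<close>
  define \<rho> :: "('g1, 'K) ratfun \<Rightarrow> ('g1 \<times> 'g2, 'K) ratfun" where "\<rho> = Const \<circ> inv_into UNIV ?C1"
  have \<rho>: "\<rho> (Const c) = Const c" for c by (simp add: \<rho>_def inv_f_f[OF inj])
  have "hom_on (range ?C1) \<rho>"
    unfolding \<rho>_def
    by (rule hom_on_comp[OF hom_on_inv_into[OF is_subfield_UNIV hom_on_field_hom[OF field_hom_Const]]
          hom_on_field_hom[OF field_hom_Const, of UNIV]]) simp
  moreover have "\<rho> ` range ?C1 = Kc" by (auto simp: \<rho> image_image)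
  ultimately obtain \<tau> where "hom_on (is_subfield hull (range ?C1 \<union> Var ` C1)) \<tau>"
    "\<And>c. c \<in> range ?C1 \<Longrightarrow> \<tau> c = \<rho> c" "\<And>h. h \<in> C1 \<Longrightarrow> \<tau> (Var h) = y h"
    using hom_on_extend[OF is_subfield_Const_image[OF is_subfield_UNIV], of \<rho> C1 Var y]
      indep_mono[OF indep_Var subset_refl, of C1] indep_y by (metis top_greatest)
  then have \<tau>: "hom_on W \<tau>" "\<And>c. \<tau> (Const c) = Const c" "\<And>h. h \<in> C1 \<Longrightarrow> \<tau> (Var h) = y h"
    by (simp_all add: ratfun_field_def \<rho>)
  note inj\<tau> = hom_on_inj[OF subfield_W \<tau>(1)]
  have \<tau>V: "\<tau> ` V = is_subfield hull (kc \<union> y ` C1)"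
  proof -
    have "\<tau> ` V = is_subfield hull (\<tau> ` (Const ` k \<union> Var ` C1))"
      unfolding ratfun_field_def[of k]
      by (rule hom_on_image_hull[OF subfield_W \<tau>(1)]) (auto intro: ratfun_field_gens)
    also have "\<tau> ` (Const ` k \<union> Var ` C1) = kc \<union> y ` C1"
      by (simp add: image_Un image_image \<tau>)
    finally show ?thesis .
  qed
  have \<tau>W: "\<tau> ` W \<subseteq> E"
  proof -
    have "\<tau> ` W = is_subfield hull (\<tau> ` (range Const \<union> Var ` C1))"
      unfolding ratfun_field_def[of UNIV C1]
      by (rule hom_on_image_hull[OF subfield_W \<tau>(1)]) (auto intro: ratfun_field_gens)
    also have "\<dots> \<subseteq> E"
      by (rule hull_minimal) (use Kc_E y_E subfield_E in \<open>auto simp: \<tau>\<close>)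
    finally show ?thesis .
  qed
  \<comment> \<open>Both composites agree on the generators; on constants this uses that
    \<open>G1\<close> acts trivially on K.\<close>
  have equiv: "\<tau> (tr h x) = \<phi> (h, \<one>\<^bsub>G2\<^esub>) (\<tau> x)" if h: "h \<in> C1" and x: "x \<in> W" for h x
  proof -
    have "hom_on W (\<tau> \<circ> tr h)"
      by (rule hom_on_comp[OF hom_on_field_hom[OF tr_simps(1)[OF h]] \<tau>(1)]) (auto simp: tr_closed h)
    moreover have "hom_on W (\<phi> (h, \<one>\<^bsub>G2\<^esub>) \<circ> \<tau>)"
      by (rule hom_on_comp[OF \<tau>(1) \<phi>_hom \<tau>W]) (use h carriers in auto)
    ultimately have "(\<tau> \<circ> tr h) x = (\<phi> (h, \<one>\<^bsub>G2\<^esub>) \<circ> \<tau>) x"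
      by (rule hom_on_eq_hull[OF subfield_W, where S = "range Const \<union> Var ` C1"])
        (use h x carriers in \<open>auto simp: tr_simps \<tau> \<phi>_Const act_G1 y_def \<phi>_z left_mult_closed ratfun_field_def intro!: hull_inc\<close>)
    then show ?thesis by simp
  qed
  have "\<tau> ` N = {x \<in> \<tau> ` V. \<forall>h\<in>C1. \<phi> (h, \<one>\<^bsub>G2\<^esub>) x = x}"
  proof -
    have "tr h x = x \<longleftrightarrow> \<phi> (h, \<one>\<^bsub>G2\<^esub>) (\<tau> x) = \<tau> x" if "h \<in> C1" "x \<in> V" for h x
      using that V_W equiv[of h x] tr_closed[of h x UNIV] inj_on_eq_iff[OF inj\<tau>, of "tr h x" x] by auto
    then show ?thesis by (auto simp: noether_field_def fixed_field_def)
  qed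
  also have "\<dots> = fixed_field (G1 \<times>\<times> G2) L \<phi>"
  proof -
    \<comment> \<open>Because \<open>(h, g)\<close> splits into \<open>(h, 1)\<close> and
      \<open>(1, g)\<close>, invariance under both factors gives invariance under the
      product.\<close>
    have *: "\<phi> (h, g) x = \<phi> (h, \<one>\<^bsub>G2\<^esub>) (\<phi> (\<one>\<^bsub>G1\<^esub>, g) x)" if "h \<in> C1" "g \<in> C2" "x \<in> L" for h g x
      using \<phi>_mult[of h "\<one>\<^bsub>G2\<^esub>" "\<one>\<^bsub>G1\<^esub>" g x] that carriers L_E by (auto simp: one_mult)
    have "x \<in> L \<and> (\<forall>g\<in>C2. \<phi> (\<one>\<^bsub>G1\<^esub>, g) x = x) \<and> (\<forall>h\<in>C1. \<phi> (h, \<one>\<^bsub>G2\<^esub>) x = x) \<longleftrightarrow>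
        x \<in> fixed_field (G1 \<times>\<times> G2) L \<phi>" for x
    proof
      assume x: "x \<in> L \<and> (\<forall>g\<in>C2. \<phi> (\<one>\<^bsub>G1\<^esub>, g) x = x) \<and> (\<forall>h\<in>C1. \<phi> (h, \<one>\<^bsub>G2\<^esub>) x = x)"
      have "\<phi> (h, g) x = x" if "h \<in> C1" "g \<in> C2" for h g
        using *[OF that] x that by simp
      with x show "x \<in> fixed_field (G1 \<times>\<times> G2) L \<phi>" by (simp add: fixed_field_def)
    qed (use carriers(1,2) in \<open>simp add: fixed_field_def\<close>)
    then show ?thesis
      unfolding \<tau>V fixed_field_L[symmetric] by (simp add: set_eq_iff conj_assoc)
  qed
  finally show ?thesis using \<tau> by (intro that)
qed

section \<open>The two implications\<close>

theorem rational_imp: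
  assumes "rational (Const ` k) N"
  shows "rational kc (fixed_field (G1 \<times>\<times> G2) E \<phi>)"
proof -
  obtain \<tau> where \<tau>: "hom_on W \<tau>" "\<And>c. \<tau> (Const c) = Const c"
    "\<tau> ` N = fixed_field (G1 \<times>\<times> G2) L \<phi>"
    by (rule noether_field_embedding) blast
  have "hom_on N \<tau>" using hom_on_subset[OF \<tau>(1)] N_V V_W by blast
  from rational_image[OF subfield_N this is_subfield_Const_image[OF subfield_k] assms]
  have "rational kc (fixed_field (G1 \<times>\<times> G2) L \<phi>)" by (simp add: \<tau> image_image)
  moreover have "indep (fixed_field (G1 \<times>\<times> G2) L \<phi>) T t"
    by (rule indep_mono[OF indep_t]) (auto simp: fixed_field_def)
  ultimately show ?thesis
    unfolding fixed_field_E by (intro rational_hull[OF subfield_kc _ _ finite_T])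
qed

text \<open>The fixed field is \<open>M(t)\<close> with \<open>M\<close> a copy of \<open>N\<close>.
  Sending \<open>t\<close> bijectively to the indeterminates below \<open>m\<close> turns it into
  \<open>ratfun_field N {..<m}\<close>. Finite generation, which \<open>stably_rational\<close>
  requires of \<open>N\<close> itself, is descended separately from \<open>M(t)\<close> to
  \<open>M\<close>.\<close>

theorem rational_imp_stably_rational:
  assumes F: "rational kc (fixed_field (G1 \<times>\<times> G2) E \<phi>)"
  shows "stably_rational (Const ` k) N"
proof -
  obtain \<tau> where \<tau>: "hom_on W \<tau>" "\<And>c. \<tau> (Const c) = Const c"
    "\<tau> ` N = fixed_field (G1 \<times>\<times> G2) L \<phi>"
    by (rule noether_field_embedding) blast
  let ?M = "fixed_field (G1 \<times>\<times> G2) L \<phi>" and ?F = "fixed_field (G1 \<times>\<times> G2) E \<phi>"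
  have \<tau>N: "hom_on N \<tau>" using hom_on_subset[OF \<tau>(1)] N_V V_W by blast
  have M: "is_subfield ?M"
    using hom_on_image_subfield[OF subfield_N \<tau>N subfield_N] \<tau>(3) by simp
  have t_M: "indep ?M T t"
    by (rule indep_mono[OF indep_t]) (auto simp: fixed_field_def)
  define \<upsilon> where "\<upsilon> = inv_into N \<tau>"
  have \<upsilon>: "hom_on ?M \<upsilon>" "\<upsilon> ` ?M = N"
    using hom_on_inv_into[OF subfield_N \<tau>N] inv_into_image_cancel[OF hom_on_inj[OF subfield_N \<tau>N], of N] \<tau>(3)
    by (simp_all add: \<upsilon>_def)
  have \<upsilon>_Const: "\<upsilon> (Const c) = Const c" if "c \<in> k" for c
    using inv_into_f_f[OF hom_on_inj[OF subfield_N \<tau>N] Const_N[OF that]] by (simp add: \<upsilon>_def \<tau>)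
  have kc_M: "kc \<subseteq> ?M"
  proof
    fix x assume "x \<in> kc"
    then obtain c where "c \<in> k" "x = Const c" by blast
    then show "x \<in> ?M" using imageI[OF Const_N, of c \<tau>] \<tau> by simp
  qed
  have "finitely_generated_extension kc ?M"
    by (rule finitely_generated_extension_cancel[OF M kc_M t_M])
      (use F in \<open>simp add: rational_def fixed_field_E\<close>)
  from finitely_generated_extension_image[OF M \<upsilon>(1) this]
  have fg: "finitely_generated_extension (Const ` k) N"
    by (simp add: \<upsilon> image_image \<upsilon>_Const)
  \<comment> \<open>The number of adjoined elements is \<open>(card C2 - 1) * card C1\<close>, which
    is zero when \<open>G2\<close> is trivial.\<close>
  define m where "m = card T"
  obtain e where e: "bij_betw e T {..<m}"
    using ex_bij_betw_finite_nat[OF finite_T] by (auto simp: m_def atLeast0LessThan)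
  \<comment> \<open>A second level of constants: the coefficient field is now itself a type of
    rational functions.\<close>
  let ?C = "Const :: ('g1, 'K) ratfun \<Rightarrow> (nat, ('g1, 'K) ratfun) ratfun"
  note C_hom = hom_on_field_hom[OF field_hom_Const, of UNIV]
  have \<sigma>: "hom_on ?M (?C \<circ> \<upsilon>)" by (rule hom_on_comp[OF \<upsilon>(1) C_hom]) simp
  have \<sigma>_image: "(?C \<circ> \<upsilon>) ` ?M = ?C ` N" by (simp only: image_comp[symmetric] \<upsilon>)
  have "indep (?C ` N) T (\<lambda>v. Var (e v))"
    by (rule indep_reindex[OF is_subfield_Const_image[OF subfield_N], where f = Var])
      (use e in \<open>auto simp: bij_betw_def intro: indep_mono[OF indep_Var]\<close>)
  then have "indep ((?C \<circ> \<upsilon>) ` ?M) T (\<lambda>v. Var (e v))" by (simp only: \<sigma>_image)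
  from hom_on_extend[OF M \<sigma> t_M this] obtain \<tau>' where
    \<tau>': "hom_on (is_subfield hull (?M \<union> t ` T)) \<tau>'" "\<And>c. c \<in> ?M \<Longrightarrow> \<tau>' c = (?C \<circ> \<upsilon>) c"
      "\<And>v. v \<in> T \<Longrightarrow> \<tau>' (t v) = Var (e v)" by blast
  have "\<tau>' ` (is_subfield hull (?M \<union> t ` T)) = is_subfield hull (\<tau>' ` (?M \<union> t ` T))"
    by (rule hom_on_image_hull[OF is_subfield_hull \<tau>'(1) hull_subset])
  also have "\<tau>' ` (?M \<union> t ` T) = ?C ` N \<union> Var ` e ` T"
    unfolding image_Un \<sigma>_image[symmetric] by (simp add: \<tau>' image_image)
  also have "e ` T = {..<m}" using e by (simp add: bij_betw_def)
  finally have image: "\<tau>' ` (is_subfield hull (?M \<union> t ` T)) = ratfun_field N {..<m}"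
    by (simp add: ratfun_field_def)
  have "\<tau>' ` kc = ?C ` Const ` k"
    using kc_M \<tau>'(2) \<upsilon>_Const by (auto simp: image_image intro!: image_cong)
  with rational_image[OF is_subfield_hull \<tau>'(1) subfield_kc F[unfolded fixed_field_E]]
  have "rational (?C ` Const ` k) (ratfun_field N {..<m})" by (simp add: image)
  with fg show ?thesis by (auto simp: stably_rational_def)
qed

end

theorem theorem4p7:
  fixes G1 :: "('g1, 'm1) monoid_scheme"
    and G2 :: "('g2, 'm2) monoid_scheme"
    and act :: "'g1 \<times> 'g2 \<Rightarrow> 'K::field \<Rightarrow> 'K"
    and k :: "'K set"
    and \<phi> :: "'g1 \<times> 'g2 \<Rightarrow> ('g1 \<times> 'g2, 'K) ratfun \<Rightarrow> ('g1 \<times> 'g2, 'K) ratfun"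
  assumes "group G1" and "group G2"
    and "finite (carrier (G1 \<times>\<times> G2))"
    and "field_action (G1 \<times>\<times> G2) UNIV act"
    and "k = fixed_field (G1 \<times>\<times> G2) UNIV act"
    and "finite_degree k UNIV"
    and "kernel (G1 \<times>\<times> G2) (field_aut_group UNIV k) act = carrier G1 \<times> {\<one>\<^bsub>G2\<^esub>}"
    and "extends_by_translation (G1 \<times>\<times> G2) UNIV act \<phi>"
  shows "(rational (Const ` k) (noether_field k G1) \<longrightarrow>
      rational (Const ` k) (fixed_field (G1 \<times>\<times> G2) (ratfun_field UNIV (carrier (G1 \<times>\<times> G2))) \<phi>)) \<and>
    (rational (Const ` k) (fixed_field (G1 \<times>\<times> G2) (ratfun_field UNIV (carrier (G1 \<times>\<times> G2))) \<phi>) \<longrightarrow>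
      stably_rational (Const ` k) (noether_field k G1))"
proof -
  interpret product_action G1 G2 act k \<phi>
    by (rule product_action.intro) (fact assms)+
  show ?thesis
    using rational_imp rational_imp_stably_rational by simp
qed

end
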